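(* Let $(R,\mathfrak m)$ be a complete local Noetherian (commutative) ring and $Q$ an $R$-module such that the quotient module $Q/JQ$ is $\mathfrak m$-adically separated for any ideal $J$ of $R$. Then for every ideal $J$ of $R$ there is a collection $\{I_\lambda\}_{\lambda\in\Lambda}$ of $\mathfrak m$-primary ideals such that $J=\bigcap_\lambda I_\lambda$ and $J^{\mathrm{cl}_Q}=\bigcap_\lambda I_\lambda^{\mathrm{cl}_Q}$. Thus $$\bigcap_{\lambda(R/I)<\infty}\operatorname{ann}(\operatorname{tom}_Q(R/I))=\bigcap_{I\text{ ideal of }R}(I:I^{\mathrm{cl}_Q}),$$ where the left-hand intersection is over ideals $I$ with $R/I$ of finite length. In particular, this holds when $Q$ is finitely generated.
   Context: $\lambda(R/I)$ denotes length. A module $N$ is $\mathfrak m$-adically separated if $\bigcap_n\mathfrak m^nN=0$. For $R$-modules $Q,M$, $\operatorname{tom}_Q(M)=\{z\in M\mid q\otimes z=0\text{ in }Q\otimes_RM\text{ for all }q\in Q\}$. The module closure $\mathrm{cl}_Q$ is defined for a submodule $N\subseteq M$ by $N^{\mathrm{cl}_Q}_M=\{u\in M\mid q\otimes u\in\operatorname{im}(Q\otimes_RN\to Q\otimes_RM)\text{ for all }q\in Q\}$; so $\operatorname{tom}_Q(M)=0^{\mathrm{cl}_Q}_M$. For an ideal $J$, $J^{\mathrm{cl}_Q}:=J^{\mathrm{cl}_Q}_R=\{a\in R\mid aQ\subseteq JQ\}$. The empty collection of ideals has intersection $R$ (relevant only for $J=R$). *)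

theory Defs
  imports
    "HOL-Algebra.Module"
    "HOL-Algebra.QuotRing"
    "HOL-Algebra.Ideal_Product"
    "HOL-Algebra.Ring_Divisibility"
    "HOL-Algebra.Free_Abelian_Groups"
    "HOL-Library.Extended_Nat"
begin

section \<open>Complete local rings and ideals\<close>

locale local_ring = cring R + maximalideal \<mm> R for \<mm> and R (structure) +
  assumes maximal_unique: "maximalideal I R \<Longrightarrow> I = \<mm>"

text \<open>Powers of an ideal are taken in the semiring \<^term>\<open>ideals_set R\<close> of ideals, so that
  the zeroth power is the whole ring. Completeness includes separatedness: every Cauchy sequence for
  the adic topology has a limit, and limits are unique.\<close>

locale complete_local_noetherian_ring = local_ring \<mm> R + noetherian_ring R
  for \<mm> and R (structure) +
  assumes adically_separated: "(\<Inter>n::nat. \<mm> [^]\<^bsub>ideals_set R\<^esub> n) = {\<zero>}"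
    and adically_Cauchy_convergent:
      "\<lbrakk>range (x :: nat \<Rightarrow> _) \<subseteq> carrier R;
        \<forall>n::nat. \<exists>N. \<forall>i\<ge>N. \<forall>j\<ge>N. x i \<ominus> x j \<in> \<mm> [^]\<^bsub>ideals_set R\<^esub> n\<rbrakk>
       \<Longrightarrow> \<exists>a \<in> carrier R. \<forall>n::nat. \<exists>N. \<forall>i\<ge>N. x i \<ominus> a \<in> \<mm> [^]\<^bsub>ideals_set R\<^esub> n"

definition radical_of :: "('a, 'm) ring_scheme \<Rightarrow> 'a set \<Rightarrow> 'a set" where
  "radical_of R I = {a \<in> carrier R. \<exists>n::nat. a [^]\<^bsub>R\<^esub> n \<in> I}"

definition primary_ideal :: "('a, 'm) ring_scheme \<Rightarrow> 'a set \<Rightarrow> bool" where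
  "primary_ideal R I \<longleftrightarrow> ideal I R \<and> I \<noteq> carrier R \<and>
     (\<forall>a \<in> carrier R. \<forall>b \<in> carrier R. a \<otimes>\<^bsub>R\<^esub> b \<in> I \<longrightarrow> a \<in> I \<or> b \<in> radical_of R I)"

definition primary_to :: "('a, 'm) ring_scheme \<Rightarrow> 'a set \<Rightarrow> 'a set \<Rightarrow> bool" where
  "primary_to R P I \<longleftrightarrow> primary_ideal R I \<and> radical_of R I = P"

definition colon :: "('a, 'm) ring_scheme \<Rightarrow> 'a set \<Rightarrow> 'a set \<Rightarrow> 'a set" where
  "colon R I J = {r \<in> carrier R. \<forall>x \<in> J. r \<otimes>\<^bsub>R\<^esub> x \<in> I}"


section \<open>Modules over a ring\<close>

definition regular_module :: "('a, 'm) ring_scheme \<Rightarrow> ('a, 'a) module" where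
  "regular_module R = \<lparr>carrier = carrier R, monoid.mult = monoid.mult R, monoid.one = monoid.one R,
     ring.zero = ring.zero R, ring.add = ring.add R, smult = monoid.mult R\<rparr>"

text \<open>The record type of modules extends that of rings; the multiplication and the unit play no
  role in the locale \<^locale>\<open>module\<close> and are left unspecified here.\<close>

definition quotient_module ::
    "('a, 'm) ring_scheme \<Rightarrow> ('a, 'b, 'n) module_scheme \<Rightarrow> 'b set \<Rightarrow> ('a, 'b set) module" where
  "quotient_module R M N = \<lparr>carrier = a_rcosets\<^bsub>M\<^esub> N, monoid.mult = undefined, monoid.one = undefined,
     ring.zero = N, ring.add = set_add M, smult = (\<lambda>r X. \<Union>x\<in>X. N +>\<^bsub>M\<^esub> (r \<odot>\<^bsub>M\<^esub> x))\<rparr>"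

definition module_span ::
    "('a, 'm) ring_scheme \<Rightarrow> ('a, 'b, 'n) module_scheme \<Rightarrow> 'b set \<Rightarrow> 'b set" where
  "module_span R M S = \<Inter>{N. submodule N R M \<and> S \<subseteq> N}"

definition finitely_generated_module ::
    "('a, 'm) ring_scheme \<Rightarrow> ('a, 'b, 'n) module_scheme \<Rightarrow> bool" where
  "finitely_generated_module R M \<longleftrightarrow>
     (\<exists>S \<subseteq> carrier M. finite S \<and> module_span R M S = carrier M)"

definition ideal_smult ::
    "('a, 'm) ring_scheme \<Rightarrow> 'a set \<Rightarrow> ('a, 'b, 'n) module_scheme \<Rightarrow> 'b set" where
  "ideal_smult R J M = module_span R M {a \<odot>\<^bsub>M\<^esub> x | a x. a \<in> J \<and> x \<in> carrier M}"

definition adically_separated_module ::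
    "('a, 'm) ring_scheme \<Rightarrow> 'a set \<Rightarrow> ('a, 'b, 'n) module_scheme \<Rightarrow> bool" where
  "adically_separated_module R \<mm> M \<longleftrightarrow>
     (\<Inter>n::nat. ideal_smult R (\<mm> [^]\<^bsub>ideals_set R\<^esub> n) M) = {\<zero>\<^bsub>M\<^esub>}"

definition module_annihilator ::
    "('a, 'm) ring_scheme \<Rightarrow> ('a, 'b, 'n) module_scheme \<Rightarrow> 'b set \<Rightarrow> 'a set" where
  "module_annihilator R M S = {r \<in> carrier R. \<forall>x \<in> S. r \<odot>\<^bsub>M\<^esub> x = \<zero>\<^bsub>M\<^esub>}"

definition module_length ::
    "('a, 'm) ring_scheme \<Rightarrow> ('a, 'b, 'n) module_scheme \<Rightarrow> enat" where
  "module_length R M = Sup {enat n | n. \<exists>N :: nat \<Rightarrow> 'b set.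
     (\<forall>i\<le>n. submodule (N i) R M) \<and> (\<forall>i<n. N i \<subset> N (Suc i))}"


section \<open>Tensor products and module closures\<close>

text \<open>The tensor product is the free abelian group on pairs modulo the subgroup generated by the
  bilinearity and balancing relations. Only its abelian group structure (written
  multiplicatively, as usual for \<^theory>\<open>HOL-Algebra.Free_Abelian_Groups\<close>) is needed.\<close>

definition tensor_relations ::
    "('a, 'm) ring_scheme \<Rightarrow> ('a, 'b, 'n) module_scheme \<Rightarrow> ('a, 'c, 'k) module_scheme
      \<Rightarrow> ('b \<times> 'c \<Rightarrow>\<^sub>0 int) set" where
  "tensor_relations R Q M = generate (free_Abelian_group (carrier Q \<times> carrier M))
     ({frag_of (p \<oplus>\<^bsub>Q\<^esub> q, z) - frag_of (p, z) - frag_of (q, z) | p q z.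
         p \<in> carrier Q \<and> q \<in> carrier Q \<and> z \<in> carrier M} \<union>
      {frag_of (q, y \<oplus>\<^bsub>M\<^esub> z) - frag_of (q, y) - frag_of (q, z) | q y z.
         q \<in> carrier Q \<and> y \<in> carrier M \<and> z \<in> carrier M} \<union>
      {frag_of (r \<odot>\<^bsub>Q\<^esub> q, z) - frag_of (q, r \<odot>\<^bsub>M\<^esub> z) | r q z.
         r \<in> carrier R \<and> q \<in> carrier Q \<and> z \<in> carrier M})"

definition tensor_product ::
    "('a, 'm) ring_scheme \<Rightarrow> ('a, 'b, 'n) module_scheme \<Rightarrow> ('a, 'c, 'k) module_scheme
      \<Rightarrow> ('b \<times> 'c \<Rightarrow>\<^sub>0 int) set monoid" where
  "tensor_product R Q M =
     free_Abelian_group (carrier Q \<times> carrier M) Mod tensor_relations R Q M"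

definition pure_tensor ::
    "('a, 'm) ring_scheme \<Rightarrow> ('a, 'b, 'n) module_scheme \<Rightarrow> ('a, 'c, 'k) module_scheme
      \<Rightarrow> 'b \<Rightarrow> 'c \<Rightarrow> ('b \<times> 'c \<Rightarrow>\<^sub>0 int) set" where
  "pure_tensor R Q M q z =
     tensor_relations R Q M #>\<^bsub>free_Abelian_group (carrier Q \<times> carrier M)\<^esub> frag_of (q, z)"

text \<open>For a linear map \<open>f\<close> from \<open>N\<close> to \<open>M\<close>, the induced map from the tensor product of \<open>Q\<close>
  with \<open>N\<close> to that of \<open>Q\<close> with \<open>M\<close>: it sends the class of a formal sum of pairs
  \<open>(q, z)\<close> to the class of the corresponding formal sum of the pairs \<open>(q, f z)\<close>.\<close>

definition tensor_map ::
    "('a, 'm) ring_scheme \<Rightarrow> ('a, 'b, 'n) module_scheme \<Rightarrow> ('a, 'd, 'l) module_scheme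
      \<Rightarrow> ('a, 'c, 'k) module_scheme \<Rightarrow> ('d \<Rightarrow> 'c)
      \<Rightarrow> ('b \<times> 'd \<Rightarrow>\<^sub>0 int) set \<Rightarrow> ('b \<times> 'c \<Rightarrow>\<^sub>0 int) set" where
  "tensor_map R Q N M f X =
     (\<Union>u\<in>X. tensor_relations R Q M #>\<^bsub>free_Abelian_group (carrier Q \<times> carrier M)\<^esub>
       frag_extend (\<lambda>(q, z). frag_of (q, f z)) u)"

definition tom ::
    "('a, 'm) ring_scheme \<Rightarrow> ('a, 'b, 'n) module_scheme \<Rightarrow> ('a, 'c, 'k) module_scheme
      \<Rightarrow> 'c set" where
  "tom R Q M =
     {z \<in> carrier M. \<forall>q \<in> carrier Q. pure_tensor R Q M q z = \<one>\<^bsub>tensor_product R Q M\<^esub>}"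

definition module_closure ::
    "('a, 'm) ring_scheme \<Rightarrow> ('a, 'b, 'n) module_scheme \<Rightarrow> ('a, 'c, 'k) module_scheme
      \<Rightarrow> 'c set \<Rightarrow> 'c set" where
  "module_closure R Q M N =
     {u \<in> carrier M. \<forall>q \<in> carrier Q.
        pure_tensor R Q M q u
          \<in> tensor_map R Q (M\<lparr>carrier := N\<rparr>) M (\<lambda>z. z) `
              carrier (tensor_product R Q (M\<lparr>carrier := N\<rparr>))}"

definition ideal_closure ::
    "('a, 'm) ring_scheme \<Rightarrow> ('a, 'b, 'n) module_scheme \<Rightarrow> 'a set \<Rightarrow> 'a set" where
  "ideal_closure R Q J = module_closure R Q (regular_module R) J"

definition cyclic_module ::
    "('a, 'm) ring_scheme \<Rightarrow> 'a set \<Rightarrow> ('a, 'a set) module" where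
  "cyclic_module R I = quotient_module R (regular_module R) I"

end

theory Submission
  imports Defs
begin

text \<open>An element \<open>a\<close> lies in the closure of an ideal \<open>J\<close> iff \<open>a Q \<subseteq> J Q\<close>; this and the
  description of \<^const>\<open>tom\<close> for cyclic modules come from the map \<open>q \<otimes> u \<mapsto> u q + J Q\<close>. The ideals
  \<open>I\<^sub>n = J + \<mm>\<^sup>n\<close> then have both required properties: they intersect in \<open>J\<close> by Krull's
  intersection theorem, and \<open>a Q \<subseteq> I\<^sub>n Q\<close> for all \<open>n\<close> forces \<open>a Q \<subseteq> J Q\<close> because \<open>Q/JQ\<close> is
  separated. For finitely generated \<open>Q\<close> the separatedness is again Krull's theorem.\<close>

section \<open>Submodules\<close>

text \<open>The annihilator identity is read off from the primary families. Since \<open>tom\<close>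
  of R/I is I^cl/I, its annihilator is the colon (I : I^cl), so the left side is the intersection on
  the right restricted to I of finite colength. If r lies in it and u in J^cl, then u lies in the
  closure of every member I of the family of J, hence r u lies in every such I and so in J. This
  takes that R/I has finite length once I contains a power of \<open>\<mm>\<close>; with length
  defined as a supremum over chains, that means a uniform bound on strict chains of ideals above I.
  The obstacle in the tensor part is that tensor products are free abelian groups modulo generated
  relations. Membership in the relations is obtained by showing that suitable elements of Q form a
  submodule containing JQ; non-membership is detected by mapping to Q/JQ. The exponents of the
  family start at 1, since \<open>\<mm>\<close>^0 = R would make the ideal improper; J = R is served
  by the empty family.\<close>

lemma set_addI: "\<lbrakk>x \<in> A; y \<in> B\<rbrakk> \<Longrightarrow> x \<oplus>\<^bsub>G\<^esub> y \<in> A <+>\<^bsub>G\<^esub> B"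
  by (auto simp: set_add_def')

lemma set_addE:
  assumes "z \<in> A <+>\<^bsub>G\<^esub> B"
  obtains x y where "x \<in> A" "y \<in> B" "z = x \<oplus>\<^bsub>G\<^esub> y"
  using assms by (auto simp: set_add_def')

context module
begin

text \<open>Negation is multiplication by -1, so closure under scalars already gives
  inverses.\<close>

lemma submoduleI':
  assumes "H \<subseteq> carrier M" "\<zero>\<^bsub>M\<^esub> \<in> H"
    and "\<And>x y. x \<in> H \<Longrightarrow> y \<in> H \<Longrightarrow> x \<oplus>\<^bsub>M\<^esub> y \<in> H"
    and smult: "\<And>a x. a \<in> carrier R \<Longrightarrow> x \<in> H \<Longrightarrow> a \<odot>\<^bsub>M\<^esub> x \<in> H"
  shows "submodule H R M"
proof (rule submoduleI)
  show "\<ominus>\<^bsub>M\<^esub> x \<in> H" if "x \<in> H" for x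
  proof -
    have "x \<in> carrier M" using that assms(1) by blast
    then have "\<ominus>\<^bsub>M\<^esub> x = (\<ominus> \<one>) \<odot>\<^bsub>M\<^esub> x" by (simp add: smult_l_minus)
    then show ?thesis using smult[OF _ that, of "\<ominus> \<one>"] by simp
  qed
qed (use assms in auto)

lemma submodule_zero: "submodule N R M \<Longrightarrow> \<zero>\<^bsub>M\<^esub> \<in> N"
  using subgroup.one_closed[OF submodule.axioms(1)] by fastforce

lemma submodule_add: "\<lbrakk>submodule N R M; x \<in> N; y \<in> N\<rbrakk> \<Longrightarrow> x \<oplus>\<^bsub>M\<^esub> y \<in> N"
  by (rule submoduleE(5))

lemma submodule_smult: "\<lbrakk>submodule N R M; a \<in> carrier R; x \<in> N\<rbrakk> \<Longrightarrow> a \<odot>\<^bsub>M\<^esub> x \<in> N"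
  by (rule submoduleE(4))

lemma submodule_minus: "\<lbrakk>submodule N R M; x \<in> N; y \<in> N\<rbrakk> \<Longrightarrow> x \<ominus>\<^bsub>M\<^esub> y \<in> N"
  unfolding a_minus_def using submoduleE(3,5) by blast

lemma submodule_subset: "submodule N R M \<Longrightarrow> N \<subseteq> carrier M"
  by (rule submoduleE(1))

lemma submodule_abelian_subgroup:
  assumes "submodule N R M"
  shows "abelian_subgroup N M"
  using assms M.abelian_group_axioms
  by (intro abelian_subgroupI3 additive_subgroup.intro) (auto simp: submodule_def)

lemma add_diff_cancel: "\<lbrakk>x \<in> carrier M; y \<in> carrier M\<rbrakk> \<Longrightarrow> (x \<oplus>\<^bsub>M\<^esub> y) \<ominus>\<^bsub>M\<^esub> x = y"
  by (simp add: M.a_comm[of x y] M.minus_eq M.a_assoc M.r_neg)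

lemma submodule_add_cancel:
  assumes "submodule N R M" "x \<in> N" "y \<in> carrier M" "x \<oplus>\<^bsub>M\<^esub> y \<in> N"
  shows "y \<in> N"
  using submodule_minus[OF assms(1,4,2)] add_diff_cancel assms submodule_subset by fastforce

lemma submodule_set_add:
  assumes "submodule N R M" "submodule K R M"
  shows "submodule (N <+>\<^bsub>M\<^esub> K) R M"
proof (rule submoduleI')
  note sub = submodule_subset[OF assms(1)] submodule_subset[OF assms(2)]
  show "N <+>\<^bsub>M\<^esub> K \<subseteq> carrier M" by (rule M.set_add_closed[OF sub])
  show "\<zero>\<^bsub>M\<^esub> \<in> N <+>\<^bsub>M\<^esub> K"
    using set_addI[OF submodule_zero[OF assms(1)] submodule_zero[OF assms(2)], of M] by simp
  fix z assume "z \<in> N <+>\<^bsub>M\<^esub> K"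
  then obtain x y where z: "x \<in> N" "y \<in> K" "z = x \<oplus>\<^bsub>M\<^esub> y" by (rule set_addE)
  show "a \<odot>\<^bsub>M\<^esub> z \<in> N <+>\<^bsub>M\<^esub> K" if "a \<in> carrier R" for a
  proof -
    have "a \<odot>\<^bsub>M\<^esub> z = a \<odot>\<^bsub>M\<^esub> x \<oplus>\<^bsub>M\<^esub> a \<odot>\<^bsub>M\<^esub> y"
      using z that sub by (simp add: smult_r_distr subset_iff)
    then show ?thesis
      using z that assms by (simp add: set_addI submodule_smult)
  qed
  fix z' assume "z' \<in> N <+>\<^bsub>M\<^esub> K"
  then obtain x' y' where z': "x' \<in> N" "y' \<in> K" "z' = x' \<oplus>\<^bsub>M\<^esub> y'" by (rule set_addE)
  have "z \<oplus>\<^bsub>M\<^esub> z' = (x \<oplus>\<^bsub>M\<^esub> x') \<oplus>\<^bsub>M\<^esub> (y \<oplus>\<^bsub>M\<^esub> y')"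
    using z z' sub by (simp add: M.add.m_ac subset_iff)
  then show "z \<oplus>\<^bsub>M\<^esub> z' \<in> N <+>\<^bsub>M\<^esub> K"
    using z z' assms by (simp add: set_addI submodule_add)
qed

lemma set_add_upper:
  assumes "submodule N R M" "submodule K R M"
  shows "N \<subseteq> N <+>\<^bsub>M\<^esub> K" "K \<subseteq> N <+>\<^bsub>M\<^esub> K"
proof -
  note sub = submodule_subset[OF assms(1)] submodule_subset[OF assms(2)]
  show "N \<subseteq> N <+>\<^bsub>M\<^esub> K"
  proof
    fix x assume "x \<in> N"
    then show "x \<in> N <+>\<^bsub>M\<^esub> K"
      using set_addI[OF _ submodule_zero[OF assms(2)], of x N M] sub by (simp add: subset_iff)
  qed
  show "K \<subseteq> N <+>\<^bsub>M\<^esub> K"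
  proof
    fix x assume "x \<in> K"
    then show "x \<in> N <+>\<^bsub>M\<^esub> K"
      using set_addI[OF submodule_zero[OF assms(1)], of x K M] sub by (simp add: subset_iff)
  qed
qed

lemma submodule_scalar_image:
  assumes "a \<in> carrier R"
  shows "submodule ((\<lambda>x. a \<odot>\<^bsub>M\<^esub> x) ` carrier M) R M"
proof (rule submoduleI')
  show "\<zero>\<^bsub>M\<^esub> \<in> (\<lambda>x. a \<odot>\<^bsub>M\<^esub> x) ` carrier M"
    using assms by (intro image_eqI[of _ _ "\<zero>\<^bsub>M\<^esub>"]) auto
  fix z assume "z \<in> (\<lambda>x. a \<odot>\<^bsub>M\<^esub> x) ` carrier M"
  then obtain x where x: "x \<in> carrier M" "z = a \<odot>\<^bsub>M\<^esub> x" by blast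
  show "b \<odot>\<^bsub>M\<^esub> z \<in> (\<lambda>x. a \<odot>\<^bsub>M\<^esub> x) ` carrier M" if b: "b \<in> carrier R" for b
  proof
    show "b \<odot>\<^bsub>M\<^esub> z = a \<odot>\<^bsub>M\<^esub> (b \<odot>\<^bsub>M\<^esub> x)"
      using b x assms by (simp add: smult_assoc1[symmetric] R.m_comm[of a b])
  qed (use b x in simp)
  fix z' assume "z' \<in> (\<lambda>x. a \<odot>\<^bsub>M\<^esub> x) ` carrier M"
  then show "z \<oplus>\<^bsub>M\<^esub> z' \<in> (\<lambda>x. a \<odot>\<^bsub>M\<^esub> x) ` carrier M"
    using x assms by (auto simp: smult_r_distr[symmetric])
qed (use assms in auto)

lemma submodule_cyclic:
  assumes "x \<in> carrier M"
  shows "submodule ((\<lambda>a. a \<odot>\<^bsub>M\<^esub> x) ` carrier R) R M"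
proof (rule submoduleI')
  show "\<zero>\<^bsub>M\<^esub> \<in> (\<lambda>a. a \<odot>\<^bsub>M\<^esub> x) ` carrier R"
    using assms by (intro image_eqI[of _ _ \<zero>]) auto
qed (use assms in \<open>auto simp: smult_l_distr[symmetric] smult_assoc1[symmetric]\<close>)

lemma mem_cyclic: "x \<in> carrier M \<Longrightarrow> x \<in> (\<lambda>a. a \<odot>\<^bsub>M\<^esub> x) ` carrier R"
  by (rule image_eqI[of _ _ \<one>]) auto

text \<open>This is (K : a) inside M. For the powers of one element these submodules form the
  ascending chain that becomes stationary in the proof of Krull's theorem.\<close>

lemma submodule_scalar_preimage:
  assumes "submodule K R M" "a \<in> carrier R"
  shows "submodule {x \<in> carrier M. a \<odot>\<^bsub>M\<^esub> x \<in> K} R M"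
proof (rule submoduleI')
  show "b \<odot>\<^bsub>M\<^esub> x \<in> {x \<in> carrier M. a \<odot>\<^bsub>M\<^esub> x \<in> K}"
    if "b \<in> carrier R" "x \<in> {x \<in> carrier M. a \<odot>\<^bsub>M\<^esub> x \<in> K}" for b x
  proof -
    have "a \<odot>\<^bsub>M\<^esub> (b \<odot>\<^bsub>M\<^esub> x) = b \<odot>\<^bsub>M\<^esub> (a \<odot>\<^bsub>M\<^esub> x)"
      using that assms by (simp add: smult_assoc1[symmetric] R.m_comm[of a b])
    then show ?thesis using that assms by (simp add: submodule_smult)
  qed
qed (use assms in \<open>auto simp: smult_r_distr submodule_zero submodule_add\<close>)

lemma submodule_Int:
  assumes "submodule N R M" "submodule K R M"
  shows "submodule (N \<inter> K) R M"
  using assms submodule_subset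
  by (intro submoduleI') (auto simp: submodule_zero submodule_add submodule_smult)

section \<open>Spans and products of an ideal with a module\<close>

lemma module_span_submodule:
  assumes "S \<subseteq> carrier M"
  shows "submodule (module_span R M S) R M"
proof (rule submoduleI')
  show "module_span R M S \<subseteq> carrier M"
    unfolding module_span_def using carrier_is_submodule assms by blast
qed (auto simp: module_span_def submodule_zero submodule_add submodule_smult)

lemma module_span_superset: "S \<subseteq> module_span R M S"
  by (auto simp: module_span_def)

lemma module_span_minimal: "\<lbrakk>submodule N R M; S \<subseteq> N\<rbrakk> \<Longrightarrow> module_span R M S \<subseteq> N"
  by (auto simp: module_span_def)

lemma ideal_smult_gens_subset: "J \<subseteq> carrier R \<Longrightarrow> {a \<odot>\<^bsub>M\<^esub> x |a x. a \<in> J \<and> x \<in> carrier M} \<subseteq> carrier M"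
  by auto

lemma ideal_smult_submodule: "J \<subseteq> carrier R \<Longrightarrow> submodule (ideal_smult R J M) R M"
  unfolding ideal_smult_def by (intro module_span_submodule ideal_smult_gens_subset)

lemma ideal_smultI: "\<lbrakk>a \<in> J; x \<in> carrier M\<rbrakk> \<Longrightarrow> a \<odot>\<^bsub>M\<^esub> x \<in> ideal_smult R J M"
  unfolding ideal_smult_def by (rule subsetD[OF module_span_superset]) blast

lemma ideal_smult_minimal:
  assumes "submodule N R M" "\<And>a x. a \<in> J \<Longrightarrow> x \<in> carrier M \<Longrightarrow> a \<odot>\<^bsub>M\<^esub> x \<in> N"
  shows "ideal_smult R J M \<subseteq> N"
  unfolding ideal_smult_def using assms(2) by (intro module_span_minimal[OF assms(1)]) blast

lemma ideal_smult_mono: "\<lbrakk>I \<subseteq> J; J \<subseteq> carrier R\<rbrakk> \<Longrightarrow> ideal_smult R I M \<subseteq> ideal_smult R J M"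
  by (rule ideal_smult_minimal[OF ideal_smult_submodule]) (simp_all add: subset_iff ideal_smultI)

text \<open>It turns a Q <= (J + \<open>\<mm>\<close>^n) Q into a Q <= J Q + \<open>\<mm>\<close>^n
  Q, the form in which separatedness of Q/JQ can be applied.\<close>

lemma ideal_smult_set_add:
  assumes "ideal I R" "ideal J R"
  shows "ideal_smult R (I <+>\<^bsub>R\<^esub> J) M \<subseteq> ideal_smult R I M <+>\<^bsub>M\<^esub> ideal_smult R J M"
proof (rule ideal_smult_minimal)
  have sub: "I \<subseteq> carrier R" "J \<subseteq> carrier R"
    using assms by (auto dest: ideal.Icarr)
  show "submodule (ideal_smult R I M <+>\<^bsub>M\<^esub> ideal_smult R J M) R M"
    using sub by (intro submodule_set_add ideal_smult_submodule)
  show "a \<odot>\<^bsub>M\<^esub> x \<in> ideal_smult R I M <+>\<^bsub>M\<^esub> ideal_smult R J M"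
    if a: "a \<in> I <+>\<^bsub>R\<^esub> J" and x: "x \<in> carrier M" for a x
  proof -
    obtain b c where bc: "b \<in> I" "c \<in> J" "a = b \<oplus> c"
      using a by (rule set_addE)
    then have "a \<odot>\<^bsub>M\<^esub> x = b \<odot>\<^bsub>M\<^esub> x \<oplus>\<^bsub>M\<^esub> c \<odot>\<^bsub>M\<^esub> x"
      using x sub by (auto intro: smult_l_distr)
    then show ?thesis
      using bc x by (simp add: set_addI ideal_smultI)
  qed
qed

end

section \<open>Noetherian induction\<close>

text \<open>A nonempty chain of ideals in a Noetherian ring contains its own union, so Zorn's lemma
  gives an inclusion-maximal member of any nonempty set of ideals. The relation descends to larger
  ideals, so such members are its minimal elements.\<close>

lemma (in noetherian_ring) wf_ideal_order:
  "wf {(I', I). ideal I R \<and> ideal I' R \<and> I \<subset> I'}"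
proof (rule wfI_min)
  fix I :: "'a set" and \<A> :: "'a set set"
  assume "I \<in> \<A>"
  show "\<exists>K\<in>\<A>. \<forall>I'. (I', K) \<in> {(I', I). ideal I R \<and> ideal I' R \<and> I \<subset> I'} \<longrightarrow> I' \<notin> \<A>"
  \<comment> \<open>A set that is not an ideal has no predecessors and is minimal itself; Zorn's
    lemma is applied to the ideals of the family only.\<close>
  proof (cases "ideal I R")
    case True
    have "\<exists>K\<in>{K \<in> \<A>. ideal K R}. \<forall>L\<in>{K \<in> \<A>. ideal K R}. K \<subseteq> L \<longrightarrow> L = K"
    proof (rule subset_Zorn)
      fix C assume C: "subset.chain {K \<in> \<A>. ideal K R} C"
      show "\<exists>U\<in>{K \<in> \<A>. ideal K R}. \<forall>L\<in>C. L \<subseteq> U"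
      proof (cases "C = {}")
        case True
        then show ?thesis using \<open>I \<in> \<A>\<close> \<open>ideal I R\<close> by blast
      next
        case False
        have "subset.chain {K. ideal K R} C"
          using C by (auto simp: subset_chain_def)
        then have "\<Union>C \<in> C" by (rule ideal_chain_is_trivial[OF False])
        then show ?thesis using C by (auto simp: subset_chain_def)
      qed
    qed
    then show ?thesis by blast
  qed (use \<open>I \<in> \<A>\<close> in blast)
qed

lemma (in noetherian_ring) ideal_noetherian_induct [consumes 1, case_names ideal]:
  assumes "ideal I R"
    and step: "\<And>I. ideal I R \<Longrightarrow> (\<And>J. ideal J R \<Longrightarrow> I \<subset> J \<Longrightarrow> P J) \<Longrightarrow> P I"
  shows "P I"
  using wf_ideal_order assms(1)
proof (induction I rule: wf_induct_rule)
  case (less I)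
  show ?case by (rule step[OF less.prems]) (use less in blast)
qed

text \<open>Induction on the generators. After q is adjoined to S, a submodule N is controlled by
  two data: the ideal of coefficients that q takes in N modulo span S, and the part of N inside span
  S. The first lives in a well-founded order because R is Noetherian, the second by induction, and
  their lexicographic product measures N.\<close>

lemma (in module) wf_submodules_of_span:
  assumes "noetherian_ring R" "finite S" "S \<subseteq> carrier M"
  shows "wf {(N', N). submodule N R M \<and> submodule N' R M \<and> N \<subset> N' \<and> N' \<subseteq> module_span R M S}"
  using assms(2,3)
proof (induction S rule: finite_induct)
  case empty
  have "submodule {\<zero>\<^bsub>M\<^esub>} R M" by (rule submoduleI') auto
  then have "module_span R M {} \<subseteq> {\<zero>\<^bsub>M\<^esub>}" by (rule module_span_minimal) simp
  then have "N = N'" if "submodule N R M" "N \<subseteq> N'" "N' \<subseteq> module_span R M {}" for N N'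
    using that submodule_zero by blast
  then have "{(N', N). submodule N R M \<and> submodule N' R M \<and> N \<subset> N' \<and> N' \<subseteq> module_span R M {}} = {}"
    by blast
  then show ?case by (simp only: wf_on_bot)
next
  case (insert q S)
  define T where "T = module_span R M S"
  have q: "q \<in> carrier M" and S: "S \<subseteq> carrier M" using insert.prems by auto
  have T: "submodule T R M" unfolding T_def by (rule module_span_submodule[OF S])
  have T_sub: "x \<in> carrier M" if "x \<in> T" for x using submodule_subset[OF T] that by blast
  \<comment> \<open>\<open>C N\<close> consists of the r with r q in N + T, that is, the image of N
    in the cyclic module (Rq + T)/T pulled back to R.\<close>
  define C where "C N = {r \<in> carrier R. \<exists>t\<in>T. r \<odot>\<^bsub>M\<^esub> q \<oplus>\<^bsub>M\<^esub> t \<in> N}" for N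
  have span: "module_span R M (insert q S) \<subseteq> (\<lambda>a. a \<odot>\<^bsub>M\<^esub> q) ` carrier R <+>\<^bsub>M\<^esub> T"
  proof (rule module_span_minimal)
    show "submodule ((\<lambda>a. a \<odot>\<^bsub>M\<^esub> q) ` carrier R <+>\<^bsub>M\<^esub> T) R M"
      by (intro submodule_set_add submodule_cyclic q T)
    show "insert q S \<subseteq> (\<lambda>a. a \<odot>\<^bsub>M\<^esub> q) ` carrier R <+>\<^bsub>M\<^esub> T"
      using set_add_upper[OF submodule_cyclic[OF q] T] mem_cyclic[OF q] module_span_superset[of S]
      unfolding T_def by blast
  qed
  have C_ideal: "ideal (C N) R" if N: "submodule N R M" for N
  proof (rule idealI)
    have smult: "x \<otimes> a \<in> C N" if "a \<in> C N" "x \<in> carrier R" for a x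
    proof -
      obtain t where t: "t \<in> T" "a \<odot>\<^bsub>M\<^esub> q \<oplus>\<^bsub>M\<^esub> t \<in> N" and a: "a \<in> carrier R"
        using \<open>a \<in> C N\<close> by (auto simp: C_def)
      have "x \<odot>\<^bsub>M\<^esub> (a \<odot>\<^bsub>M\<^esub> q \<oplus>\<^bsub>M\<^esub> t) = (x \<otimes> a) \<odot>\<^bsub>M\<^esub> q \<oplus>\<^bsub>M\<^esub> x \<odot>\<^bsub>M\<^esub> t"
        using t a that q T_sub by (simp add: smult_r_distr smult_assoc1)
      then have "(x \<otimes> a) \<odot>\<^bsub>M\<^esub> q \<oplus>\<^bsub>M\<^esub> x \<odot>\<^bsub>M\<^esub> t \<in> N"
        using submodule_smult[OF N \<open>x \<in> carrier R\<close> t(2)] by simp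
      then show ?thesis
        unfolding C_def using a that submodule_smult[OF T \<open>x \<in> carrier R\<close> t(1)] by blast
    qed
    show "x \<otimes> a \<in> C N" if "a \<in> C N" "x \<in> carrier R" for a x
      using smult that .
    show "a \<otimes> x \<in> C N" if "a \<in> C N" "x \<in> carrier R" for a x
      using smult[OF that] that by (simp add: C_def R.m_comm)
    show "subgroup (C N) (add_monoid R)"
    proof (rule R.add.subgroupI)
      show "C N \<subseteq> carrier R" by (auto simp: C_def)
      have "\<zero> \<odot>\<^bsub>M\<^esub> q \<oplus>\<^bsub>M\<^esub> \<zero>\<^bsub>M\<^esub> \<in> N"
        using q submodule_zero[OF N] by simp
      then have "\<zero> \<in> C N"
        unfolding C_def using submodule_zero[OF T] by blast
      then show "C N \<noteq> {}" by blast
      show "\<ominus> a \<in> C N" if "a \<in> C N" for a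
      proof -
        have "a \<in> carrier R" using that by (simp add: C_def)
        then have "\<ominus> a = \<ominus> \<one> \<otimes> a" by (simp add: R.l_minus)
        then show ?thesis using smult[OF that, of "\<ominus> \<one>"] by simp
      qed
      show "a \<oplus> b \<in> C N" if ab: "a \<in> C N" "b \<in> C N" for a b
      proof -
        obtain t u where t: "t \<in> T" "a \<odot>\<^bsub>M\<^esub> q \<oplus>\<^bsub>M\<^esub> t \<in> N" and u: "u \<in> T" "b \<odot>\<^bsub>M\<^esub> q \<oplus>\<^bsub>M\<^esub> u \<in> N"
          and c: "a \<in> carrier R" "b \<in> carrier R"
          using ab by (auto simp: C_def)
        have "(a \<odot>\<^bsub>M\<^esub> q \<oplus>\<^bsub>M\<^esub> t) \<oplus>\<^bsub>M\<^esub> (b \<odot>\<^bsub>M\<^esub> q \<oplus>\<^bsub>M\<^esub> u) = (a \<oplus> b) \<odot>\<^bsub>M\<^esub> q \<oplus>\<^bsub>M\<^esub> (t \<oplus>\<^bsub>M\<^esub> u)"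
          using t u c q T_sub by (simp add: smult_l_distr M.add.m_ac)
        then have "(a \<oplus> b) \<odot>\<^bsub>M\<^esub> q \<oplus>\<^bsub>M\<^esub> (t \<oplus>\<^bsub>M\<^esub> u) \<in> N"
          using submodule_add[OF N t(2) u(2)] by simp
        then show ?thesis
          unfolding C_def using c submodule_add[OF T t(1) u(1)] by blast
      qed
    qed
  qed (rule R.ring_axioms)
  \<comment> \<open>Nested submodules with equal data coincide: x = r q + t in N' differs from some
    r q + u in N by t - u, which lies in N' \<inter> T = N \<inter> T.\<close>
  have key: "N' \<subseteq> N"
    if N: "submodule N R M" "submodule N' R M" "N \<subseteq> N'" "N' \<subseteq> module_span R M (insert q S)"
      and eq: "C N = C N'" "N \<inter> T = N' \<inter> T" for N N'
  proof
    fix x assume x: "x \<in> N'"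
    then have "x \<in> (\<lambda>a. a \<odot>\<^bsub>M\<^esub> q) ` carrier R <+>\<^bsub>M\<^esub> T" using N(4) span by blast
    then obtain r t where r: "r \<in> carrier R" "t \<in> T" "x = r \<odot>\<^bsub>M\<^esub> q \<oplus>\<^bsub>M\<^esub> t"
      by (auto elim!: set_addE)
    then have "r \<in> C N'" using x by (auto simp: C_def)
    then obtain u where u: "u \<in> T" "r \<odot>\<^bsub>M\<^esub> q \<oplus>\<^bsub>M\<^esub> u \<in> N" using eq by (auto simp: C_def)
    have d: "x \<ominus>\<^bsub>M\<^esub> (r \<odot>\<^bsub>M\<^esub> q \<oplus>\<^bsub>M\<^esub> u) \<in> N'"
      using submodule_minus[OF N(2) x] u N(3) by blast
    have e: "x = (r \<odot>\<^bsub>M\<^esub> q \<oplus>\<^bsub>M\<^esub> u) \<oplus>\<^bsub>M\<^esub> (t \<ominus>\<^bsub>M\<^esub> u)"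
    proof -
      have "(r \<odot>\<^bsub>M\<^esub> q \<oplus>\<^bsub>M\<^esub> u) \<oplus>\<^bsub>M\<^esub> (t \<ominus>\<^bsub>M\<^esub> u) = (r \<odot>\<^bsub>M\<^esub> q \<oplus>\<^bsub>M\<^esub> t) \<oplus>\<^bsub>M\<^esub> (u \<ominus>\<^bsub>M\<^esub> u)"
        using r(1,2) u(1) q T_sub by (simp add: M.minus_eq M.add.m_ac)
      then show ?thesis using r u(1) q T_sub by (simp add: M.minus_eq M.r_neg)
    qed
    have tu: "t \<ominus>\<^bsub>M\<^esub> u \<in> T" by (rule submodule_minus[OF T r(2) u(1)])
    have "t \<ominus>\<^bsub>M\<^esub> u \<in> N'"
      by (rule submodule_add_cancel[OF N(2), of "r \<odot>\<^bsub>M\<^esub> q \<oplus>\<^bsub>M\<^esub> u"])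
        (use u N(3) x e tu T_sub in auto)
    then have "t \<ominus>\<^bsub>M\<^esub> u \<in> N" using tu eq by blast
    from submodule_add[OF N(1) u(2) this] show "x \<in> N" unfolding e[symmetric] .
  qed
  let ?I = "{(I', I). ideal I R \<and> ideal I' R \<and> I \<subset> I'}"
  let ?T = "{(N', N). submodule N R M \<and> submodule N' R M \<and> N \<subset> N' \<and> N' \<subseteq> T}"
  show ?case
  proof (rule wf_subset)
    show "wf (inv_image (?I <*lex*> ?T) (\<lambda>N. (C N, N \<inter> T)))"
      using noetherian_ring.wf_ideal_order[OF assms(1)] insert.IH[OF S]
      unfolding T_def[symmetric] by (intro wf_inv_image wf_lex_prod)
    show "{(N', N). submodule N R M \<and> submodule N' R M \<and> N \<subset> N' \<and> N' \<subseteq> module_span R M (insert q S)}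
        \<subseteq> inv_image (?I <*lex*> ?T) (\<lambda>N. (C N, N \<inter> T))"
    proof (rule subrelI)
      fix N' N
      assume "(N', N) \<in> {(N', N). submodule N R M \<and> submodule N' R M \<and> N \<subset> N' \<and> N' \<subseteq> module_span R M (insert q S)}"
      then have N: "submodule N R M" "submodule N' R M" "N \<subset> N'" "N' \<subseteq> module_span R M (insert q S)"
        by simp_all
      \<comment> \<open>Both coordinates grow weakly, and by \<open>key\<close> at least one of them
        strictly; this is a step in the lexicographic order.\<close>
      have "C N \<subseteq> C N'" using N(3) by (auto simp: C_def)
      moreover have "N \<inter> T \<subseteq> N' \<inter> T" using N(3) by blast
      moreover have "C N \<noteq> C N' \<or> N \<inter> T \<noteq> N' \<inter> T" using key[of N N'] N by blast
      ultimately show "(N', N) \<in> inv_image (?I <*lex*> ?T) (\<lambda>N. (C N, N \<inter> T))"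
        using C_ideal[OF N(1)] C_ideal[OF N(2)] submodule_Int[OF N(1) T] submodule_Int[OF N(2) T]
        by auto
    qed
  qed
qed

text \<open>Krull's theorem uses this twice: for a largest submodule avoiding a given element, and
  to make an ascending sequence of submodules stationary.\<close>

lemma (in module) finitely_generated_maximal_submodule:
  assumes "noetherian_ring R" "finitely_generated_module R M"
    and "N \<in> \<A>" "\<And>K. K \<in> \<A> \<Longrightarrow> submodule K R M"
  obtains K where "K \<in> \<A>" "\<And>L. L \<in> \<A> \<Longrightarrow> K \<subseteq> L \<Longrightarrow> L = K"
proof -
  obtain S where S: "S \<subseteq> carrier M" "finite S" "module_span R M S = carrier M"
    using assms(2) by (auto simp: finitely_generated_module_def)
  let ?r = "{(N', N). submodule N R M \<and> submodule N' R M \<and> N \<subset> N' \<and> N' \<subseteq> carrier M}"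
  have "wf ?r"
    using wf_submodules_of_span[OF assms(1) S(2,1)] unfolding S(3) .
  from wfE_min[OF this assms(3)] obtain K where K: "K \<in> \<A>" "\<And>L. (L, K) \<in> ?r \<Longrightarrow> L \<notin> \<A>"
    by blast
  show thesis
  proof (rule that[OF K(1)])
    fix L assume L: "L \<in> \<A>" "K \<subseteq> L"
    then show "L = K"
      using K(2)[of L] assms(4)[OF K(1)] assms(4)[OF L(1)] submodule_subset[of L] by blast
  qed
qed

section \<open>Noetherian local rings and the Krull intersection theorem\<close>

locale noetherian_local_ring = local_ring \<mm> R + noetherian_ring R
  for \<mm> and R (structure)
begin

abbreviation mpow :: "nat \<Rightarrow> 'a set" where
  "mpow n \<equiv> \<mm> [^]\<^bsub>ideals_set R\<^esub> n"

lemma max_ideal: "ideal \<mm> R" ..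

lemma ideal_carr: "ideal I R \<Longrightarrow> I \<subseteq> carrier R"
  by (auto dest: ideal.Icarr)

text \<open>Noetherian induction climbs from a proper ideal that is not maximal to a strictly larger
  proper one, and \<open>maximal_unique\<close> identifies where the climb ends.\<close>

lemma proper_ideal_le_max:
  assumes "ideal I R" "I \<noteq> carrier R"
  shows "I \<subseteq> \<mm>"
  using assms
proof (induction I rule: ideal_noetherian_induct)
  case (ideal I)
  show ?case
  proof (cases "maximalideal I R")
    case True
    then show ?thesis using maximal_unique by blast
  next
    case False
    then obtain J where "ideal J R" "I \<subseteq> J" "J \<noteq> I" "J \<noteq> carrier R"
      using ideal.hyps ideal.prems maximalidealI[of I R] by blast
    then show ?thesis using ideal.IH[of J] by blast
  qed
qed

lemma one_notin_max: "\<one> \<notin> \<mm>"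
  using I_notcarr ideal.one_imp_carrier[OF max_ideal] by blast

lemma Units_iff_notin_max:
  assumes "a \<in> carrier R"
  shows "a \<in> Units R \<longleftrightarrow> a \<notin> \<mm>"
proof
  assume a: "a \<in> Units R"
  show "a \<notin> \<mm>"
  proof
    assume "a \<in> \<mm>"
    then have "inv a \<otimes> a \<in> \<mm>" using a by (intro I_l_closed) auto
    then show False using a one_notin_max by simp
  qed
next
  assume "a \<notin> \<mm>"
  moreover have "a \<in> PIdl a" by (rule cgenideal_self[OF assms])
  ultimately have "PIdl a = carrier R"
    using proper_ideal_le_max[OF cgenideal_ideal[OF assms]] by blast
  then have "\<one> \<in> PIdl a" by simp
  then obtain b where "b \<in> carrier R" "\<one> = b \<otimes> a" by (auto simp: cgenideal_def)
  then show "a \<in> Units R" using assms m_comm[of a b] by (auto simp: Units_def)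
qed

text \<open>This is the unit by which a Nakayama-style argument divides in Krull's theorem.\<close>

lemma one_minus_Units:
  assumes "a \<in> \<mm>"
  shows "\<one> \<ominus> a \<in> Units R"
proof -
  have a: "a \<in> carrier R" using assms by (rule Icarr)
  have "\<one> \<ominus> a \<notin> \<mm>"
  proof
    assume "\<one> \<ominus> a \<in> \<mm>"
    then have "(\<one> \<ominus> a) \<oplus> a \<in> \<mm>" using assms by (rule a_closed)
    moreover have "(\<one> \<ominus> a) \<oplus> a = \<one>"
      using a by (simp add: minus_eq a_assoc l_neg)
    ultimately show False using one_notin_max by simp
  qed
  then show ?thesis using a by (simp add: Units_iff_notin_max)
qed

lemma one_ideals_set [simp]: "\<one>\<^bsub>ideals_set R\<^esub> = carrier R"
  by (simp add: ideals_set_def)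

lemma mult_ideals_set [simp]: "I \<otimes>\<^bsub>ideals_set R\<^esub> J = I \<cdot> J"
  by (simp add: ideals_set_def)

lemma mpow_ideal: "ideal (mpow n) R"
  by (induction n) (simp_all add: oneideal ideal_prod_is_ideal max_ideal)

lemma mpow_carr: "mpow n \<subseteq> carrier R"
  by (rule ideal_carr[OF mpow_ideal])

lemma mpow_1: "mpow (Suc 0) = \<mm>"
  by (simp add: ideal_prod_commute[OF oneideal max_ideal] ideal_prod_one[OF max_ideal])

lemma mpow_add: "mpow (i + j) = mpow i \<cdot> mpow j"
  by (induction j)
    (simp_all add: ideal_prod_one mpow_ideal ideal_prod_assoc max_ideal)

text \<open>The exponent must be positive because the zeroth power is the whole ring.\<close>

lemma mpow_Suc_le_max: "mpow (Suc n) \<subseteq> \<mm>"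
  using ideal_prod_inter[OF mpow_ideal max_ideal] by auto

lemma pow_mem_mpow: "a \<in> \<mm> \<Longrightarrow> a [^] n \<in> mpow n"
  by (induction n) (simp_all add: ideal_prod.prod)

lemma ideal_prod_subset:
  assumes "ideal A R" "\<And>i j. i \<in> I \<Longrightarrow> j \<in> J \<Longrightarrow> i \<otimes> j \<in> A"
  shows "I \<cdot> J \<subseteq> A"
proof
  fix x assume "x \<in> I \<cdot> J"
  then show "x \<in> A"
    by induction (auto intro: assms(2) additive_subgroup.a_closed[OF ideal.axioms(1)[OF assms(1)]])
qed

lemma ideal_colon_element:
  assumes "ideal A R" "b \<in> carrier R"
  shows "ideal {x \<in> carrier R. b \<otimes> x \<in> A} R"
  using ideal.helper_max_prime[OF assms(1) is_cring assms(2)] .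

text \<open>Noetherian induction takes the place of counting generators of \<open>\<mm>\<close>: if
  A does not contain \<open>\<mm>\<close>, then A contains a product of two strictly larger ideals,
  each of which contains a power of \<open>\<mm>\<close> by induction.\<close>

lemma mpow_le_of_radical:
  assumes "ideal A R" "\<And>a. a \<in> \<mm> \<Longrightarrow> \<exists>n::nat. a [^] n \<in> A"
  shows "\<exists>n. mpow n \<subseteq> A"
  using assms
proof (induction A rule: ideal_noetherian_induct)
  case (ideal A)
  show ?case
  proof (cases "\<mm> \<subseteq> A")
    case True
    then show ?thesis using mpow_1 by blast
  next
    case False
    then obtain a where a: "a \<in> \<mm>" "a \<notin> A" by blast
    then have ac: "a \<in> carrier R" by (simp add: Icarr)
    \<comment> \<open>With n least, a^(n-1) lies outside A while its product with a lies inside; n =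
      0 would put 1 into A.\<close>
    define n where "n = (LEAST n::nat. a [^] n \<in> A)"
    have n: "a [^] n \<in> A" unfolding n_def using ideal.prems[OF a(1)] by (rule LeastI_ex)
    show ?thesis
    proof (cases n)
      case 0
      then have "A = carrier R" using n ideal.one_imp_carrier[OF ideal.hyps] by simp
      then show ?thesis using mpow_carr by blast
    next
      case (Suc k)
      define b where "b = a [^] k"
      have b: "b \<in> carrier R" using ac by (simp add: b_def)
      have bA: "b \<notin> A" unfolding b_def using not_less_Least[of k "\<lambda>n. a [^] n \<in> A"] Suc n_def by simp
      have ba: "b \<otimes> a \<in> A" using n Suc by (simp add: b_def)
      \<comment> \<open>The two larger ideals are (A : b) and A + (b). The element a shows that the
        first is strictly larger than A, and b does so for the second.\<close>
      define B where "B = {x \<in> carrier R. b \<otimes> x \<in> A}"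
      define C where "C = A <+>\<^bsub>R\<^esub> PIdl b"
      have B: "ideal B R" unfolding B_def by (rule ideal_colon_element[OF ideal.hyps b])
      have P: "ideal (PIdl b) R" by (rule cgenideal_ideal[OF b])
      have C: "ideal C R" unfolding C_def by (rule add_ideals[OF ideal.hyps P])
      have AB: "A \<subset> B"
      proof
        show "A \<subseteq> B"
          unfolding B_def using ideal_carr[OF ideal.hyps] ideal.I_l_closed[OF ideal.hyps _ b] by blast
        show "A \<noteq> B" using ba ac a(2) by (auto simp: B_def)
      qed
      have AC: "A \<subset> C"
      proof -
        have "A \<subseteq> C"
        proof
          fix x assume "x \<in> A"
          then show "x \<in> C"
            using set_addI[of x A \<zero> "PIdl b" R] ideal_carr[OF ideal.hyps]
              additive_subgroup.zero_closed[OF ideal.axioms(1)[OF P]]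
            by (auto simp: C_def subset_iff)
        qed
        moreover have "b \<in> C"
          using set_addI[of \<zero> A b "PIdl b" R] cgenideal_self[OF b] b
            additive_subgroup.zero_closed[OF ideal.axioms(1)[OF ideal.hyps]]
          by (simp add: C_def)
        ultimately show ?thesis using bA by blast
      qed
      obtain i j where ij: "mpow i \<subseteq> B" "mpow j \<subseteq> C"
        using ideal.IH[OF B AB] ideal.IH[OF C AC] ideal.prems AB AC by blast
      \<comment> \<open>The exponents add up because (A + (b)) (A : b) <= A.\<close>
      have "mpow (j + i) \<subseteq> A"
        unfolding mpow_add
      proof (rule ideal_prod_subset[OF ideal.hyps])
        fix x y assume "x \<in> mpow j" "y \<in> mpow i"
        then have xy: "x \<in> C" "y \<in> B" using ij by auto
        then obtain u v where uv: "u \<in> A" "v \<in> PIdl b" "x = u \<oplus> v"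
          unfolding C_def by (blast elim: set_addE)
        then obtain r where r: "r \<in> carrier R" "v = r \<otimes> b" by (auto simp: cgenideal_def)
        have y: "y \<in> carrier R" "b \<otimes> y \<in> A" using xy by (auto simp: B_def)
        have u: "u \<in> carrier R" using uv(1) ideal_carr[OF ideal.hyps] by blast
        have "x \<otimes> y = u \<otimes> y \<oplus> r \<otimes> (b \<otimes> y)"
          using uv r y u b by (simp add: l_distr m_assoc)
        then show "x \<otimes> y \<in> A"
          using ideal.I_r_closed[OF ideal.hyps uv(1) y(1)] ideal.I_l_closed[OF ideal.hyps y(2) r(1)]
            additive_subgroup.a_closed[OF ideal.axioms(1)[OF ideal.hyps]] by simp
      qed
      then show ?thesis by blast
    qed
  qed
qed

text \<open>Instead of the Artin--Rees lemma we use a submodule \<open>K\<close> maximal among those that contain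
  \<open>N\<close> but not \<open>x\<close>: every strictly larger submodule contains \<open>x\<close>, which forces
  \<open>\<mm> x \<subseteq> K\<close> and then \<open>\<mm>\<^sup>n M \<subseteq> K\<close> for some \<open>n\<close>.\<close>

theorem Krull_intersection:
  assumes "module R M" "finitely_generated_module R M" "submodule N R M"
    and "x \<in> carrier M" "\<And>n. x \<in> N <+>\<^bsub>M\<^esub> ideal_smult R (mpow n) M"
  shows "x \<in> N"
proof (rule ccontr)
  assume "x \<notin> N"
  interpret M: module R M by fact
  let ?\<A> = "{K. submodule K R M \<and> N \<subseteq> K \<and> x \<notin> K}"
  obtain K where "K \<in> ?\<A>" and max: "\<And>L. L \<in> ?\<A> \<Longrightarrow> K \<subseteq> L \<Longrightarrow> L = K"
    using M.finitely_generated_maximal_submodule[OF noetherian_ring_axioms assms(2), of N ?\<A>]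
      assms(3) \<open>x \<notin> N\<close> by blast
  then have K: "submodule K R M" "N \<subseteq> K" "x \<notin> K" by auto
  note K_sub = M.submodule_subset[OF K(1)]
  \<comment> \<open>K + L contains N and misses x, so maximality forces it to equal K. Read
    contrapositively: any L not inside K satisfies x in K + L.\<close>
  have larger: "L \<subseteq> K" if L: "submodule L R M" "x \<notin> K <+>\<^bsub>M\<^esub> L" for L
  proof -
    have "K <+>\<^bsub>M\<^esub> L = K"
      using M.set_add_upper[OF K(1) L(1)] M.submodule_set_add[OF K(1) L(1)] L(2) K(2)
      by (intro max) auto
    then show ?thesis using M.set_add_upper[OF K(1) L(1)] by blast
  qed
  have mx: "a \<odot>\<^bsub>M\<^esub> x \<in> K" if a: "a \<in> \<mm>" for a
  proof (rule ccontr)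
    assume notin: "a \<odot>\<^bsub>M\<^esub> x \<notin> K"
    have ac: "a \<in> carrier R" using a by (rule Icarr)
    have ax: "a \<odot>\<^bsub>M\<^esub> x \<in> carrier M" using ac assms(4) by simp
    \<comment> \<open>From x = k + r a x one gets (1 - r a) x = k in K. As a lies in
      \<open>\<mm>\<close>, the factor is a unit, and x would lie in K.\<close>
    have "x \<in> K <+>\<^bsub>M\<^esub> (\<lambda>r. r \<odot>\<^bsub>M\<^esub> (a \<odot>\<^bsub>M\<^esub> x)) ` carrier R"
      using larger[OF M.submodule_cyclic[OF ax]] M.mem_cyclic[OF ax] notin by blast
    then obtain k r where k: "k \<in> K" and r: "r \<in> carrier R" and x: "x = k \<oplus>\<^bsub>M\<^esub> r \<odot>\<^bsub>M\<^esub> (a \<odot>\<^bsub>M\<^esub> x)"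
      by (auto elim!: set_addE)
    have kc: "k \<in> carrier M" using k K_sub by blast
    let ?u = "\<one> \<ominus> r \<otimes> a"
    have u: "?u \<in> Units R" using one_minus_Units I_l_closed[OF a r] by blast
    have "x \<oplus>\<^bsub>M\<^esub> (\<ominus>\<^bsub>M\<^esub> (r \<odot>\<^bsub>M\<^esub> (a \<odot>\<^bsub>M\<^esub> x))) = k"
      by (subst x) (use kc r ac assms(4) in \<open>simp add: M.M.a_assoc M.M.r_neg\<close>)
    then have "?u \<odot>\<^bsub>M\<^esub> x = k"
      using r ac assms(4) by (simp add: minus_eq M.smult_l_distr M.smult_l_minus M.smult_assoc1)
    then have "inv ?u \<odot>\<^bsub>M\<^esub> (?u \<odot>\<^bsub>M\<^esub> x) \<in> K"
      using k u by (auto intro: M.submodule_smult[OF K(1)])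
    then have "x \<in> K"
      using u assms(4) by (simp add: M.smult_assoc1[symmetric] Units_closed)
    then show False using K(3) by blast
  qed
  have pow: "\<exists>n::nat. \<forall>y\<in>carrier M. a [^] n \<odot>\<^bsub>M\<^esub> y \<in> K" if a: "a \<in> \<mm>" for a
  proof -
    have ac: "a \<in> carrier R" using a by (rule Icarr)
    \<comment> \<open>D n = (K : a^n) increases with n, so D (n+1) = D n for some n. For this n, a^n
      M lies in K: otherwise x = k + a^n y with k in K, and a x in K gives a^(n+1) y in K, so y is
      in D (n+1) = D n and x would lie in K.\<close>
    define D where "D n = {y \<in> carrier M. a [^] (n::nat) \<odot>\<^bsub>M\<^esub> y \<in> K}" for n
    have D: "submodule (D n) R M" for n
      unfolding D_def using ac by (intro M.submodule_scalar_preimage[OF K(1)]) simp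
    have shift: "a [^] Suc n \<odot>\<^bsub>M\<^esub> y = a \<odot>\<^bsub>M\<^esub> (a [^] n \<odot>\<^bsub>M\<^esub> y)" if "y \<in> carrier M" for n y
      using ac that by (simp add: M.smult_assoc1[symmetric] m_comm)
    obtain S where "S \<in> range D" and stab: "\<And>L. L \<in> range D \<Longrightarrow> S \<subseteq> L \<Longrightarrow> L = S"
      using M.finitely_generated_maximal_submodule[OF noetherian_ring_axioms assms(2), of "D 0" "range D"] D
      by blast
    then obtain n where S: "S = D n" by blast
    have "D n \<subseteq> D (Suc n)"
      unfolding D_def using shift M.submodule_smult[OF K(1) ac] by auto
    then have Dn: "D (Suc n) = D n" using stab[of "D (Suc n)"] S by blast
    let ?L = "(\<lambda>y. a [^] n \<odot>\<^bsub>M\<^esub> y) ` carrier M"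
    have L: "submodule ?L R M" using ac by (intro M.submodule_scalar_image) simp
    have "x \<notin> K <+>\<^bsub>M\<^esub> ?L"
    proof
      assume "x \<in> K <+>\<^bsub>M\<^esub> ?L"
      then obtain k y where k: "k \<in> K" and y: "y \<in> carrier M" and x: "x = k \<oplus>\<^bsub>M\<^esub> a [^] n \<odot>\<^bsub>M\<^esub> y"
        by (auto elim!: set_addE)
      have kc: "k \<in> carrier M" using k K_sub by blast
      have "a \<odot>\<^bsub>M\<^esub> x = a \<odot>\<^bsub>M\<^esub> k \<oplus>\<^bsub>M\<^esub> a [^] Suc n \<odot>\<^bsub>M\<^esub> y"
        unfolding shift[OF y] by (subst x) (use kc y ac in \<open>simp add: M.smult_r_distr\<close>)
      then have "a [^] Suc n \<odot>\<^bsub>M\<^esub> y \<in> K"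
        using mx[OF a] y ac
        by (metis M.submodule_add_cancel[OF K(1) M.submodule_smult[OF K(1) ac k]] M.smult_closed nat_pow_closed)
      then have "y \<in> D (Suc n)" using y unfolding D_def by blast
      then have "y \<in> D n" by (simp only: Dn)
      then have "x \<in> K" unfolding D_def by (subst x) (blast intro: M.submodule_add[OF K(1) k])
      then show False using K(3) by blast
    qed
    then have "?L \<subseteq> K" by (rule larger[OF L])
    then show ?thesis by blast
  qed
  \<comment> \<open>A is the annihilator of M/K. By \<open>pow\<close> every element of
    \<open>\<mm>\<close> has a power in it, so some power of the ideal \<open>\<mm>\<close>
    annihilates M/K. Then N + \<open>\<mm>\<close>^n M lies in K, contrary to x not in K.\<close>
  define A where "A = {r \<in> carrier R. \<forall>y\<in>carrier M. r \<odot>\<^bsub>M\<^esub> y \<in> K}"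
  have A: "ideal A R"
  proof (rule idealI)
    have smult: "r \<otimes> a \<in> A" if "a \<in> A" "r \<in> carrier R" for a r
      using that M.submodule_smult[OF K(1)] by (auto simp: A_def M.smult_assoc1)
    show "r \<otimes> a \<in> A" if "a \<in> A" "r \<in> carrier R" for a r
      using smult that .
    show "a \<otimes> r \<in> A" if "a \<in> A" "r \<in> carrier R" for a r
      using smult[OF that] that by (simp add: A_def m_comm)
    show "subgroup A (add_monoid R)"
    proof (rule add.subgroupI)
      have "\<zero> \<in> A" using M.submodule_zero[OF K(1)] by (simp add: A_def)
      then show "A \<noteq> {}" by blast
      show "\<ominus> a \<in> A" if "a \<in> A" for a
        using that M.submoduleE(3)[OF K(1)] by (auto simp: A_def M.smult_l_minus)
      show "a \<oplus> b \<in> A" if "a \<in> A" "b \<in> A" for a b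
        using that M.submodule_add[OF K(1)] by (auto simp: A_def M.smult_l_distr)
    qed (auto simp: A_def)
  qed (rule ring_axioms)
  have "\<exists>n::nat. a [^] n \<in> A" if "a \<in> \<mm>" for a
    using pow[OF that] Icarr[OF that] unfolding A_def by auto
  then obtain n where n: "mpow n \<subseteq> A" using mpow_le_of_radical[OF A] by blast
  have "ideal_smult R (mpow n) M \<subseteq> K"
    by (rule M.ideal_smult_minimal[OF K(1)]) (use n A_def in blast)
  then have "N <+>\<^bsub>M\<^esub> ideal_smult R (mpow n) M \<subseteq> K"
    using K(2) M.submodule_add[OF K(1)] by (auto elim!: set_addE)
  then show False using assms(5)[of n] K(3) by blast
qed

end

section \<open>Quotient modules\<close>

lemma quotient_module_simps [simp]:
  "carrier (quotient_module R M N) = a_rcosets\<^bsub>M\<^esub> N"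
  "\<zero>\<^bsub>quotient_module R M N\<^esub> = N"
  "X \<oplus>\<^bsub>quotient_module R M N\<^esub> Y = X <+>\<^bsub>M\<^esub> Y"
  "r \<odot>\<^bsub>quotient_module R M N\<^esub> X = (\<Union>x\<in>X. N +>\<^bsub>M\<^esub> (r \<odot>\<^bsub>M\<^esub> x))"
  by (simp_all add: quotient_module_def)

context module
begin

lemma coset_mem_rcosets: "\<lbrakk>submodule N R M; x \<in> carrier M\<rbrakk> \<Longrightarrow> N +>\<^bsub>M\<^esub> x \<in> a_rcosets\<^bsub>M\<^esub> N"
  by (intro M.a_rcosetsI submodule_subset)

lemma rcosetsE:
  assumes "X \<in> a_rcosets\<^bsub>M\<^esub> N"
  obtains x where "x \<in> carrier M" "X = N +>\<^bsub>M\<^esub> x"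
  using assms by (auto simp: A_RCOSETS_def')

lemma coset_eq_submodule_iff:
  assumes "submodule N R M" "x \<in> carrier M"
  shows "N +>\<^bsub>M\<^esub> x = N \<longleftrightarrow> x \<in> N"
  using M.a_coset_join1[of N x] M.a_coset_join2[of x N] assms
  by (auto dest: submodule.axioms(1))

lemma coset_add:
  assumes "submodule N R M" "x \<in> carrier M" "y \<in> carrier M"
  shows "(N +>\<^bsub>M\<^esub> x) <+>\<^bsub>M\<^esub> (N +>\<^bsub>M\<^esub> y) = N +>\<^bsub>M\<^esub> (x \<oplus>\<^bsub>M\<^esub> y)"
  by (rule abelian_subgroup.a_rcos_sum[OF submodule_abelian_subgroup[OF assms(1)] assms(2,3)])

lemma coset_absorb:
  assumes "submodule N R M" "n \<in> N" "x \<in> carrier M"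
  shows "N +>\<^bsub>M\<^esub> (n \<oplus>\<^bsub>M\<^esub> x) = N +>\<^bsub>M\<^esub> x"
proof -
  have n: "n \<in> carrier M" using submodule_subset[OF assms(1)] assms(2) by blast
  have "N +>\<^bsub>M\<^esub> (n \<oplus>\<^bsub>M\<^esub> x) = (N +>\<^bsub>M\<^esub> n) +>\<^bsub>M\<^esub> x"
    using M.a_coset_add_assoc[OF submodule_subset[OF assms(1)] n assms(3)] by simp
  also have "N +>\<^bsub>M\<^esub> n = N" using coset_eq_submodule_iff[OF assms(1) n] assms(2) by simp
  finally show ?thesis .
qed

text \<open>Maps on cosets are encoded as unions over representatives; such a union collapses to one
  value when the map does not depend on the representative. This covers both scalar multiplication
  on quotients and the balanced map used for \<open>tom\<close>.\<close>

lemma coset_UN: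
  assumes "submodule N R M" "x \<in> carrier M"
    and "\<And>n. n \<in> N \<Longrightarrow> f (n \<oplus>\<^bsub>M\<^esub> x) = f x"
  shows "(\<Union>y\<in>N +>\<^bsub>M\<^esub> x. f y) = f x"
  using assms(3) submodule_zero[OF assms(1)] by (auto simp: a_r_coset_def')

lemma smult_coset:
  assumes "submodule N R M" "x \<in> carrier M" "r \<in> carrier R"
  shows "(\<Union>y\<in>N +>\<^bsub>M\<^esub> x. N +>\<^bsub>M\<^esub> (r \<odot>\<^bsub>M\<^esub> y)) = N +>\<^bsub>M\<^esub> (r \<odot>\<^bsub>M\<^esub> x)"
proof (rule coset_UN[OF assms(1,2)])
  fix n assume n: "n \<in> N"
  then have "n \<in> carrier M" using submodule_subset[OF assms(1)] by blast
  then show "N +>\<^bsub>M\<^esub> (r \<odot>\<^bsub>M\<^esub> (n \<oplus>\<^bsub>M\<^esub> x)) = N +>\<^bsub>M\<^esub> (r \<odot>\<^bsub>M\<^esub> x)"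
    using assms n by (simp add: smult_r_distr coset_absorb submodule_smult)
qed

theorem quotient_module_is_module:
  assumes N: "submodule N R M"
  shows "module R (quotient_module R M N)"
proof -
  let ?Q = "quotient_module R M N"
  note [simp] = coset_add[OF N] smult_coset[OF N] coset_mem_rcosets[OF N]
  have coset_zero: "N +>\<^bsub>M\<^esub> \<zero>\<^bsub>M\<^esub> = N" using submodule_subset[OF N] by simp
  have zero_add: "N <+>\<^bsub>M\<^esub> (N +>\<^bsub>M\<^esub> x) = N +>\<^bsub>M\<^esub> x" if "x \<in> carrier M" for x
    using coset_add[OF N M.zero_closed that] that unfolding coset_zero by simp
  have "abelian_group ?Q"
  proof (rule abelian_groupI)
    show "\<zero>\<^bsub>?Q\<^esub> \<in> carrier ?Q"
      using coset_mem_rcosets[OF N M.zero_closed] coset_zero by simp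
    show "\<exists>Y\<in>carrier ?Q. Y \<oplus>\<^bsub>?Q\<^esub> X = \<zero>\<^bsub>?Q\<^esub>" if "X \<in> carrier ?Q" for X
    proof -
      obtain x where x: "x \<in> carrier M" "X = N +>\<^bsub>M\<^esub> x"
        using \<open>X \<in> carrier ?Q\<close> by (auto elim: rcosetsE)
      show ?thesis
        by (rule bexI[of _ "N +>\<^bsub>M\<^esub> (\<ominus>\<^bsub>M\<^esub> x)"]) (use x coset_zero in \<open>simp_all add: M.l_neg\<close>)
    qed
  qed (auto elim!: rcosetsE simp: M.a_ac zero_add)
  then show ?thesis
    by (intro moduleI; (simp only: quotient_module_simps)?; (elim rcosetsE)?;
        simp add: smult_l_distr smult_r_distr smult_assoc1 R.is_cring)
qed

text \<open>Half of the correspondence theorem. It transfers separatedness from M/N to M and lifts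
  chains of submodules of R/I to chains of ideals above I.\<close>

lemma submodule_quotient_preimage:
  assumes "submodule N R M" "submodule H R (quotient_module R M N)"
  shows "submodule {x \<in> carrier M. N +>\<^bsub>M\<^esub> x \<in> H} R M"
    and "N \<subseteq> {x \<in> carrier M. N +>\<^bsub>M\<^esub> x \<in> H}"
proof -
  note H = submodule.axioms(1)[OF assms(2)]
  have zero: "N \<in> H" using subgroup.one_closed[OF H] by simp
  show "N \<subseteq> {x \<in> carrier M. N +>\<^bsub>M\<^esub> x \<in> H}"
  proof
    fix n assume n: "n \<in> N"
    then have "n \<in> carrier M" using submodule_subset[OF assms(1)] by blast
    then show "n \<in> {x \<in> carrier M. N +>\<^bsub>M\<^esub> x \<in> H}"
      using coset_eq_submodule_iff[OF assms(1), of n] n zero by simp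
  qed
  show "submodule {x \<in> carrier M. N +>\<^bsub>M\<^esub> x \<in> H} R M"
  proof (rule submoduleI')
    show "\<zero>\<^bsub>M\<^esub> \<in> {x \<in> carrier M. N +>\<^bsub>M\<^esub> x \<in> H}"
      using zero submodule_subset[OF assms(1)] by simp
    show "x \<oplus>\<^bsub>M\<^esub> y \<in> {x \<in> carrier M. N +>\<^bsub>M\<^esub> x \<in> H}"
      if "x \<in> {x \<in> carrier M. N +>\<^bsub>M\<^esub> x \<in> H}" "y \<in> {x \<in> carrier M. N +>\<^bsub>M\<^esub> x \<in> H}" for x y
      using that subgroup.m_closed[OF H, of "N +>\<^bsub>M\<^esub> x" "N +>\<^bsub>M\<^esub> y"]
      by (simp add: coset_add[OF assms(1)])
    show "a \<odot>\<^bsub>M\<^esub> x \<in> {x \<in> carrier M. N +>\<^bsub>M\<^esub> x \<in> H}"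
      if "a \<in> carrier R" "x \<in> {x \<in> carrier M. N +>\<^bsub>M\<^esub> x \<in> H}" for a x
      using that submodule.smult_closed[OF assms(2), of a "N +>\<^bsub>M\<^esub> x"]
      by (simp add: smult_coset[OF assms(1)])
  qed simp
qed

text \<open>The preimage in M of \<open>\<mm>\<close>^n (M/N) contains N + \<open>\<mm>\<close>^n M,
  so the coset of x lies in every \<open>\<mm>\<close>^n (M/N) and vanishes.\<close>

lemma adically_separated_quotientD:
  assumes N: "submodule N R M" and "\<And>n. \<mm> [^]\<^bsub>ideals_set R\<^esub> (n::nat) \<subseteq> carrier R"
    and "adically_separated_module R \<mm> (quotient_module R M N)"
    and x: "x \<in> carrier M" "\<And>n. x \<in> N <+>\<^bsub>M\<^esub> ideal_smult R (\<mm> [^]\<^bsub>ideals_set R\<^esub> (n::nat)) M"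
  shows "x \<in> N"
proof -
  have "N +>\<^bsub>M\<^esub> x \<in> ideal_smult R (\<mm> [^]\<^bsub>ideals_set R\<^esub> n) (quotient_module R M N)" for n :: nat
    \<comment> \<open>A span is an intersection of submodules H, so each H containing the generators
      is tested separately, through its preimage in M.\<close>
    unfolding ideal_smult_def module_span_def
  proof (rule InterI, clarify)
    fix H
    assume H: "submodule H R (quotient_module R M N)"
      and gens: "{a \<odot>\<^bsub>quotient_module R M N\<^esub> X |a X.
          a \<in> \<mm> [^]\<^bsub>ideals_set R\<^esub> n \<and> X \<in> carrier (quotient_module R M N)} \<subseteq> H"
    let ?P = "{x \<in> carrier M. N +>\<^bsub>M\<^esub> x \<in> H}"
    note P = submodule_quotient_preimage[OF N H]
    have "ideal_smult R (\<mm> [^]\<^bsub>ideals_set R\<^esub> n) M \<subseteq> ?P"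
    proof (rule ideal_smult_minimal[OF P(1)])
      fix a y assume a: "a \<in> \<mm> [^]\<^bsub>ideals_set R\<^esub> n" and y: "y \<in> carrier M"
      then have "a \<odot>\<^bsub>quotient_module R M N\<^esub> (N +>\<^bsub>M\<^esub> y) \<in> H"
        using gens coset_mem_rcosets[OF N y] by (auto simp del: quotient_module_simps(4))
      moreover have ac: "a \<in> carrier R" using a assms(2) by blast
      ultimately show "a \<odot>\<^bsub>M\<^esub> y \<in> ?P"
        using y by (simp add: smult_coset[OF N])
    qed
    then have "N <+>\<^bsub>M\<^esub> ideal_smult R (\<mm> [^]\<^bsub>ideals_set R\<^esub> n) M \<subseteq> ?P"
      using P(2) submodule_add[OF P(1)] by (auto elim!: set_addE)
    then show "N +>\<^bsub>M\<^esub> x \<in> H" using x(2)[of n] by blast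
  qed
  then have "N +>\<^bsub>M\<^esub> x = N" using assms(3) by (auto simp: adically_separated_module_def)
  then show "x \<in> N" using coset_eq_submodule_iff[OF N x(1)] by simp
qed

end

section \<open>The ring as a module over itself\<close>

lemma regular_module_simps [simp]:
  "carrier (regular_module R) = carrier R"
  "\<zero>\<^bsub>regular_module R\<^esub> = \<zero>\<^bsub>R\<^esub>"
  "x \<oplus>\<^bsub>regular_module R\<^esub> y = x \<oplus>\<^bsub>R\<^esub> y"
  "r \<odot>\<^bsub>regular_module R\<^esub> x = r \<otimes>\<^bsub>R\<^esub> x"
  "A +>\<^bsub>regular_module R\<^esub> x = A +>\<^bsub>R\<^esub> x"
  "A <+>\<^bsub>regular_module R\<^esub> B = A <+>\<^bsub>R\<^esub> B"
  "a_rcosets\<^bsub>regular_module R\<^esub> A = a_rcosets\<^bsub>R\<^esub> A"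
  by (simp_all add: regular_module_def a_r_coset_def' A_RCOSETS_def' set_add_def')

context cring
begin

lemma module_regular: "module R (regular_module R)"
proof (rule moduleI)
  show "abelian_group (regular_module R)"
    by (rule abelian_groupI) (auto simp: a_ac intro: bexI[of _ "\<ominus> _"] l_neg)
qed (auto simp: l_distr r_distr m_assoc is_cring)

lemma submodule_regular_iff: "submodule I R (regular_module R) \<longleftrightarrow> ideal I R"
proof
  interpret reg: module R "regular_module R" by (rule module_regular)
  show "submodule I R (regular_module R)" if "ideal I R"
  proof -
    interpret ideal I R by fact
    show ?thesis by (rule reg.submoduleI') (auto intro: I_l_closed)
  qed
  assume I: "submodule I R (regular_module R)"
  note sub = reg.submodule_subset[OF I, simplified]
  show "ideal I R"
  proof (rule idealI)
    show l: "x \<otimes> a \<in> I" if "a \<in> I" "x \<in> carrier R" for a x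
      using reg.submodule_smult[OF I that(2,1)] by simp
    show "a \<otimes> x \<in> I" if "a \<in> I" "x \<in> carrier R" for a x
      using l[OF that] that sub by (metis m_comm subsetD)
    show "subgroup I (add_monoid R)"
    proof (rule add.subgroupI)
      show "I \<noteq> {}" using reg.submodule_zero[OF I] by auto
      show "a \<oplus> b \<in> I" if "a \<in> I" "b \<in> I" for a b
        using reg.submodule_add[OF I that] by simp
      show "\<ominus> a \<in> I" if "a \<in> I" for a
      proof -
        have "a \<in> carrier R" using that sub by blast
        then show ?thesis using l[OF that, of "\<ominus> \<one>"] by (simp add: l_minus)
      qed
    qed (rule sub)
  qed (rule ring_axioms)
qed

lemma finitely_generated_regular: "finitely_generated_module R (regular_module R)"
proof -
  interpret reg: module R "regular_module R" by (rule module_regular)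
  have "submodule (module_span R (regular_module R) {\<one>}) R (regular_module R)"
    by (rule reg.module_span_submodule) simp
  then have "ideal (module_span R (regular_module R) {\<one>}) R"
    by (simp add: submodule_regular_iff)
  moreover have "\<one> \<in> module_span R (regular_module R) {\<one>}"
    using reg.module_span_superset[of "{\<one>}"] by blast
  ultimately have "module_span R (regular_module R) {\<one>} = carrier R"
    by (rule ideal.one_imp_carrier)
  then show ?thesis
    unfolding finitely_generated_module_def by (intro exI[of _ "{\<one>}"]) simp
qed

end

lemma (in noetherian_local_ring) ideal_Krull_intersection:
  assumes "ideal J R" "x \<in> carrier R" "\<And>n. x \<in> J <+>\<^bsub>R\<^esub> mpow n"
  shows "x \<in> J"
proof -
  interpret reg: module R "regular_module R" by (rule module_regular)
  have le: "mpow n \<subseteq> ideal_smult R (mpow n) (regular_module R)" for n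
  proof
    fix a assume a: "a \<in> mpow n"
    then have "a \<in> carrier R" using mpow_carr by blast
    then show "a \<in> ideal_smult R (mpow n) (regular_module R)"
      using reg.ideal_smultI[OF a, of \<one>] by simp
  qed
  show ?thesis
  proof (rule Krull_intersection[OF module_regular finitely_generated_regular])
    show "submodule J R (regular_module R)" using assms(1) by (simp add: submodule_regular_iff)
    show "x \<in> J <+>\<^bsub>regular_module R\<^esub> ideal_smult R (mpow n) (regular_module R)" for n
      using assms(3)[of n] le[of n] by (auto elim!: set_addE intro!: set_addI)
  qed (use assms in simp)
qed

section \<open>Tensor products with cyclic modules\<close>

text \<open>For the inclusion of a submodule, the map inside \<open>tensor_map\<close> thus leaves
  formal sums unchanged; what remains is the passage to cosets of the larger relation group.\<close>

lemma frag_extend_pair: "frag_extend (\<lambda>(x, y). frag_of (x, y)) u = u"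
  for u :: "'x \<times> 'y \<Rightarrow>\<^sub>0 int"
proof -
  have "(\<lambda>(x, y). frag_of (x, y)) = (frag_of :: 'x \<times> 'y \<Rightarrow> _)" by auto
  then show ?thesis by (simp add: frag_expansion[symmetric])
qed

section \<open>Relations of the tensor product and balanced maps\<close>

locale module_pair = Q: module R Q + M: module R M
  for R (structure) and Q and M
begin

abbreviation F where "F \<equiv> free_Abelian_group (carrier Q \<times> carrier M)"

abbreviation rels where "rels \<equiv> tensor_relations R Q M"

lemma tensor_relations_incl:
  shows "\<lbrakk>p \<in> carrier Q; q \<in> carrier Q; z \<in> carrier M\<rbrakk>
      \<Longrightarrow> frag_of (p \<oplus>\<^bsub>Q\<^esub> q, z) - frag_of (p, z) - frag_of (q, z) \<in> rels"
    and "\<lbrakk>q \<in> carrier Q; y \<in> carrier M; z \<in> carrier M\<rbrakk>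
      \<Longrightarrow> frag_of (q, y \<oplus>\<^bsub>M\<^esub> z) - frag_of (q, y) - frag_of (q, z) \<in> rels"
    and "\<lbrakk>r \<in> carrier R; q \<in> carrier Q; z \<in> carrier M\<rbrakk>
      \<Longrightarrow> frag_of (r \<odot>\<^bsub>Q\<^esub> q, z) - frag_of (q, r \<odot>\<^bsub>M\<^esub> z) \<in> rels"
  unfolding tensor_relations_def by (rule generate.incl, blast)+

lemma F_diff_closed: "\<lbrakk>x \<in> carrier F; y \<in> carrier F\<rbrakk> \<Longrightarrow> x - y \<in> carrier F"
  using keys_diff[of x y] by auto

lemma tensor_relations_least:
  assumes H: "subgroup H F"
    and "\<And>p q z. \<lbrakk>p \<in> carrier Q; q \<in> carrier Q; z \<in> carrier M\<rbrakk>
      \<Longrightarrow> frag_of (p \<oplus>\<^bsub>Q\<^esub> q, z) - frag_of (p, z) - frag_of (q, z) \<in> H"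
    and "\<And>q y z. \<lbrakk>q \<in> carrier Q; y \<in> carrier M; z \<in> carrier M\<rbrakk>
      \<Longrightarrow> frag_of (q, y \<oplus>\<^bsub>M\<^esub> z) - frag_of (q, y) - frag_of (q, z) \<in> H"
    and "\<And>r q z. \<lbrakk>r \<in> carrier R; q \<in> carrier Q; z \<in> carrier M\<rbrakk>
      \<Longrightarrow> frag_of (r \<odot>\<^bsub>Q\<^esub> q, z) - frag_of (q, r \<odot>\<^bsub>M\<^esub> z) \<in> H"
  shows "rels \<subseteq> H"
  unfolding tensor_relations_def
proof (rule group.generate_subgroup_incl[OF group_free_Abelian_group _ H], intro Un_least subsetI)
qed (elim CollectE exE conjE; simp only: assms)+

lemma subgroup_tensor_relations: "subgroup rels F"
  unfolding tensor_relations_def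
proof (rule group.generate_is_subgroup[OF group_free_Abelian_group], intro Un_least subsetI)
  fix w
  show "w \<in> carrier F" if "w \<in> {frag_of (p \<oplus>\<^bsub>Q\<^esub> q, z) - frag_of (p, z) - frag_of (q, z) |p q z.
      p \<in> carrier Q \<and> q \<in> carrier Q \<and> z \<in> carrier M}"
    using that by (auto simp del: carrier_free_Abelian_group_iff intro!: F_diff_closed)
  show "w \<in> carrier F" if "w \<in> {frag_of (q, y \<oplus>\<^bsub>M\<^esub> z) - frag_of (q, y) - frag_of (q, z) |q y z.
      q \<in> carrier Q \<and> y \<in> carrier M \<and> z \<in> carrier M}"
    using that by (auto simp del: carrier_free_Abelian_group_iff intro!: F_diff_closed)
  show "w \<in> carrier F" if "w \<in> {frag_of (r \<odot>\<^bsub>Q\<^esub> q, z) - frag_of (q, r \<odot>\<^bsub>M\<^esub> z) |r q z.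
      r \<in> carrier R \<and> q \<in> carrier Q \<and> z \<in> carrier M}"
    using that by (auto simp del: carrier_free_Abelian_group_iff intro!: F_diff_closed)
qed

lemma tensor_relations_diff:
  assumes "x \<in> rels" "y \<in> rels"
  shows "x - y \<in> rels"
proof -
  have y: "y \<in> carrier F" using subgroup.subset[OF subgroup_tensor_relations] assms(2) by blast
  have "x \<otimes>\<^bsub>F\<^esub> inv\<^bsub>F\<^esub> y \<in> rels"
    by (intro subgroup.m_closed[OF subgroup_tensor_relations]
        subgroup.m_inv_closed[OF subgroup_tensor_relations] assms)
  then show ?thesis using y by simp
qed

lemma pure_tensor_eq_one_iff:
  assumes "q \<in> carrier Q" "z \<in> carrier M"
  shows "pure_tensor R Q M q z = \<one>\<^bsub>tensor_product R Q M\<^esub> \<longleftrightarrow> frag_of (q, z) \<in> rels"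
proof -
  have "frag_of (q, z) \<in> carrier F" using assms by simp
  then show ?thesis
    using group.coset_join1[OF group_free_Abelian_group _ _ subgroup_tensor_relations]
      group.coset_join2[OF group_free_Abelian_group _ subgroup_tensor_relations]
    by (auto simp: pure_tensor_def tensor_product_def FactGroup_def)
qed

text \<open>The universal property, stated on the free group instead of its quotient: a balanced
  biadditive map gives a homomorphism that kills the relations. It serves to show that an element is
  not a relation.\<close>

lemma tensor_relations_hom:
  assumes G: "comm_group G"
    and closed: "\<And>q z. q \<in> carrier Q \<Longrightarrow> z \<in> carrier M \<Longrightarrow> f q z \<in> carrier G"
    and left: "\<And>p q z. \<lbrakk>p \<in> carrier Q; q \<in> carrier Q; z \<in> carrier M\<rbrakk>
      \<Longrightarrow> f (p \<oplus>\<^bsub>Q\<^esub> q) z = f p z \<otimes>\<^bsub>G\<^esub> f q z"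
    and right: "\<And>q y z. \<lbrakk>q \<in> carrier Q; y \<in> carrier M; z \<in> carrier M\<rbrakk>
      \<Longrightarrow> f q (y \<oplus>\<^bsub>M\<^esub> z) = f q y \<otimes>\<^bsub>G\<^esub> f q z"
    and balanced: "\<And>r q z. \<lbrakk>r \<in> carrier R; q \<in> carrier Q; z \<in> carrier M\<rbrakk>
      \<Longrightarrow> f (r \<odot>\<^bsub>Q\<^esub> q) z = f q (r \<odot>\<^bsub>M\<^esub> z)"
  obtains h where "group_hom F G h"
    and "\<And>q z. q \<in> carrier Q \<Longrightarrow> z \<in> carrier M \<Longrightarrow> h (frag_of (q, z)) = f q z"
    and "\<And>w. w \<in> rels \<Longrightarrow> h w = \<one>\<^bsub>G\<^esub>"
proof -
  interpret G: comm_group G by fact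
  have "(\<lambda>(q, z). f q z) ` (carrier Q \<times> carrier M) \<subseteq> carrier G"
    using closed by auto
  then obtain h where h: "h \<in> hom F G"
    and of: "\<And>x. x \<in> carrier Q \<times> carrier M \<Longrightarrow> h (frag_of x) = (\<lambda>(q, z). f q z) x"
    by (rule G.free_Abelian_group_universal) blast
  have of': "h (frag_of (q, z)) = f q z" if "q \<in> carrier Q" "z \<in> carrier M" for q z
    using of[of "(q, z)"] that by simp
  have hom: "group_hom F G h"
    using h G.group_axioms group_free_Abelian_group
    by (intro group_hom.intro group_hom_axioms.intro)
  interpret hom: group_hom F G h by fact
  have diff: "h (x - y) = h x \<otimes>\<^bsub>G\<^esub> inv\<^bsub>G\<^esub> (h y)" if "x \<in> carrier F" "y \<in> carrier F" for x y
    using hom.hom_mult[of x "- y"] hom.hom_inv[of y] that by simp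
  have frag: "frag_of (q, z) \<in> carrier F" if "q \<in> carrier Q" "z \<in> carrier M" for q z
    using that by simp
  \<comment> \<open>The value of a biadditivity relation, f(p + q) - f(p) - f(q), written
    multiplicatively in G.\<close>
  have cancel: "a \<otimes>\<^bsub>G\<^esub> b \<otimes>\<^bsub>G\<^esub> inv\<^bsub>G\<^esub> a \<otimes>\<^bsub>G\<^esub> inv\<^bsub>G\<^esub> b = \<one>\<^bsub>G\<^esub>"
    if "a \<in> carrier G" "b \<in> carrier G" for a b
  proof -
    have "a \<otimes>\<^bsub>G\<^esub> b \<otimes>\<^bsub>G\<^esub> inv\<^bsub>G\<^esub> a = b \<otimes>\<^bsub>G\<^esub> (a \<otimes>\<^bsub>G\<^esub> inv\<^bsub>G\<^esub> a)"
      using that by (subst G.m_comm[OF that]) (simp only: G.m_assoc G.inv_closed)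
    then show ?thesis using that by simp
  qed
  note ker = kernel_def diff of' frag F_diff_closed closed
  have "rels \<subseteq> kernel F G h"
  proof (rule tensor_relations_least[OF hom.subgroup_kernel])
    show "frag_of (p \<oplus>\<^bsub>Q\<^esub> q, z) - frag_of (p, z) - frag_of (q, z) \<in> kernel F G h"
      if "p \<in> carrier Q" "q \<in> carrier Q" "z \<in> carrier M" for p q z
      using that by (simp add: ker left cancel del: carrier_free_Abelian_group_iff)
    show "frag_of (q, y \<oplus>\<^bsub>M\<^esub> z) - frag_of (q, y) - frag_of (q, z) \<in> kernel F G h"
      if "q \<in> carrier Q" "y \<in> carrier M" "z \<in> carrier M" for q y z
      using that by (simp add: ker right cancel del: carrier_free_Abelian_group_iff)
    show "frag_of (r \<odot>\<^bsub>Q\<^esub> q, z) - frag_of (q, r \<odot>\<^bsub>M\<^esub> z) \<in> kernel F G h"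
      if "r \<in> carrier R" "q \<in> carrier Q" "z \<in> carrier M" for r q z
      using that by (simp add: ker balanced del: carrier_free_Abelian_group_iff)
  qed
  then have "h w = \<one>\<^bsub>G\<^esub>" if "w \<in> rels" for w using that by (auto simp: kernel_def)
  with hom of' show thesis by (rule that)
qed

text \<open>The condition ranges over all \<open>z\<close> because it is preserved by scalars only through
  the balancing relation.\<close>

lemma tensor_null_submodule:
  assumes rels: "rels \<subseteq> H" and diff: "\<And>x y. x \<in> H \<Longrightarrow> y \<in> H \<Longrightarrow> x - y \<in> H"
  shows "submodule {q \<in> carrier Q. \<forall>z\<in>carrier M. frag_of (q, z) \<in> H} R Q"
proof (rule Q.submoduleI')
  have "0 \<in> H" using diff subgroup.one_closed[OF subgroup_tensor_relations] rels by auto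
  then have minus: "- x \<in> H" if "x \<in> H" for x using diff[of 0 x] that by simp
  have add: "x + y \<in> H" if "x \<in> H" "y \<in> H" for x y
    using diff[OF that(1) minus[OF that(2)]] by simp
  \<comment> \<open>The additivity relation for 0 + 0 = 0 reads (0, z) - (0, z) - (0, z) = -(0,
    z).\<close>
  have "frag_of (\<zero>\<^bsub>Q\<^esub>, z) \<in> H" if "z \<in> carrier M" for z
    using tensor_relations_incl(1)[of "\<zero>\<^bsub>Q\<^esub>" "\<zero>\<^bsub>Q\<^esub>" z] that rels minus[of "- frag_of (\<zero>\<^bsub>Q\<^esub>, z)"] by auto
  then show "\<zero>\<^bsub>Q\<^esub> \<in> {q \<in> carrier Q. \<forall>z\<in>carrier M. frag_of (q, z) \<in> H}" by simp
  fix q assume q: "q \<in> {q \<in> carrier Q. \<forall>z\<in>carrier M. frag_of (q, z) \<in> H}"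
  show "r \<odot>\<^bsub>Q\<^esub> q \<in> {q \<in> carrier Q. \<forall>z\<in>carrier M. frag_of (q, z) \<in> H}" if r: "r \<in> carrier R" for r
  proof -
    have "frag_of (r \<odot>\<^bsub>Q\<^esub> q, z) \<in> H" if z: "z \<in> carrier M" for z
      using add[of "frag_of (r \<odot>\<^bsub>Q\<^esub> q, z) - frag_of (q, r \<odot>\<^bsub>M\<^esub> z)" "frag_of (q, r \<odot>\<^bsub>M\<^esub> z)"]
        tensor_relations_incl(3)[OF r, of q z] q r z rels by auto
    then show ?thesis using q r by simp
  qed
  fix p assume p: "p \<in> {q \<in> carrier Q. \<forall>z\<in>carrier M. frag_of (q, z) \<in> H}"
  have "frag_of (q \<oplus>\<^bsub>Q\<^esub> p, z) \<in> H" if z: "z \<in> carrier M" for z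
    using add[OF add[of "frag_of (q \<oplus>\<^bsub>Q\<^esub> p, z) - frag_of (q, z) - frag_of (p, z)" "frag_of (p, z)"],
        of "frag_of (q, z)"]
      tensor_relations_incl(1)[of q p z] q p z rels by auto
  then show "q \<oplus>\<^bsub>Q\<^esub> p \<in> {q \<in> carrier Q. \<forall>z\<in>carrier M. frag_of (q, z) \<in> H}" using q p by simp
qed auto

lemma frag_of_zero_right:
  assumes "q \<in> carrier Q"
  shows "frag_of (q, \<zero>\<^bsub>M\<^esub>) \<in> rels"
  using tensor_relations_diff[OF _ tensor_relations_incl(2)[OF assms M.zero_closed M.zero_closed], of 0]
    subgroup.one_closed[OF subgroup_tensor_relations] by simp

text \<open>Cosets are eliminated: being in the image of the tensor product with N becomes an
  equation between formal sums, a relation over M plus a sum supported on Q x N.\<close>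

lemma pure_tensor_in_image_iff:
  assumes N: "submodule N R M" and q: "q \<in> carrier Q" and z: "z \<in> carrier M"
  shows "pure_tensor R Q M q z \<in> tensor_map R Q (M\<lparr>carrier := N\<rparr>) M (\<lambda>z. z) `
            carrier (tensor_product R Q (M\<lparr>carrier := N\<rparr>))
    \<longleftrightarrow> (\<exists>t\<in>rels. \<exists>w\<in>carrier (free_Abelian_group (carrier Q \<times> N)). frag_of (q, z) = t + w)"
proof -
  let ?N = "M\<lparr>carrier := N\<rparr>"
  let ?F' = "free_Abelian_group (carrier Q \<times> N)"
  interpret N: module_pair R Q ?N
    by (intro module_pair.intro Q.module_axioms submodule.submodule_is_module[OF N] M.module_axioms)
  have N_sub: "N \<subseteq> carrier M" by (rule M.submodule_subset[OF N])
  have prod_sub: "carrier Q \<times> N \<subseteq> carrier Q \<times> carrier M" using N_sub by blast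
  have F'_sub: "carrier ?F' \<subseteq> carrier F"
  proof
    fix w assume "w \<in> carrier ?F'"
    then have "Poly_Mapping.keys w \<subseteq> carrier Q \<times> N" by simp
    from order_trans[OF this prod_sub] show "w \<in> carrier F" by simp
  qed
  \<comment> \<open>Relations over N remain relations over M, so \<open>tensor_map\<close> sends a
    coset to a single coset. The intersection with \<open>carrier ?F'\<close> provides a subgroup of
    the smaller free group, as \<open>tensor_relations_least\<close> requires.\<close>
  have "tensor_relations R Q ?N \<subseteq> rels \<inter> carrier ?F'"
  proof (rule N.tensor_relations_least)
    have minus: "- x \<in> rels" if "x \<in> rels" for x
      using tensor_relations_diff[OF _ that, of 0] subgroup.one_closed[OF subgroup_tensor_relations] by simp
    have add: "x + y \<in> rels" if "x \<in> rels" "y \<in> rels" for x y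
      using tensor_relations_diff[OF that(1) minus[OF that(2)]] by simp
    show "subgroup (rels \<inter> carrier ?F') (free_Abelian_group (carrier Q \<times> carrier ?N))"
    proof (rule group.subgroupI[OF group_free_Abelian_group])
      show "rels \<inter> carrier ?F' \<noteq> {}"
        using subgroup.one_closed[OF subgroup_tensor_relations] by auto
      show "x \<otimes>\<^bsub>free_Abelian_group (carrier Q \<times> carrier ?N)\<^esub> y \<in> rels \<inter> carrier ?F'"
        if "x \<in> rels \<inter> carrier ?F'" "y \<in> rels \<inter> carrier ?F'" for x y
        using that add[of x y] keys_add[of x y] by auto
    qed (use minus in auto)
    show "frag_of (p \<oplus>\<^bsub>Q\<^esub> q, z) - frag_of (p, z) - frag_of (q, z) \<in> rels \<inter> carrier ?F'"
      if "p \<in> carrier Q" "q \<in> carrier Q" "z \<in> carrier ?N" for p q z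
      using that N_sub tensor_relations_incl(1)[of p q z]
        N.F_diff_closed[OF N.F_diff_closed, of "frag_of (p \<oplus>\<^bsub>Q\<^esub> q, z)" "frag_of (p, z)" "frag_of (q, z)"]
      by auto
    show "frag_of (q, y \<oplus>\<^bsub>?N\<^esub> z) - frag_of (q, y) - frag_of (q, z) \<in> rels \<inter> carrier ?F'"
      if "q \<in> carrier Q" "y \<in> carrier ?N" "z \<in> carrier ?N" for q y z
      using that N_sub tensor_relations_incl(2)[of q y z] M.submodule_add[OF N, of y z]
        N.F_diff_closed[OF N.F_diff_closed, of "frag_of (q, y \<oplus>\<^bsub>M\<^esub> z)" "frag_of (q, y)" "frag_of (q, z)"]
      by auto
    show "frag_of (r \<odot>\<^bsub>Q\<^esub> q, z) - frag_of (q, r \<odot>\<^bsub>?N\<^esub> z) \<in> rels \<inter> carrier ?F'"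
      if "r \<in> carrier R" "q \<in> carrier Q" "z \<in> carrier ?N" for r q z
      using that N_sub tensor_relations_incl(3)[of r q z] M.submodule_smult[OF N, of r z]
        N.F_diff_closed[of "frag_of (r \<odot>\<^bsub>Q\<^esub> q, z)" "frag_of (q, r \<odot>\<^bsub>M\<^esub> z)"]
      by auto
  qed
  then have rels': "t \<in> rels" "t \<in> carrier ?F'" if "t \<in> tensor_relations R Q ?N" for t
    using that by blast+
  have absorb: "rels #>\<^bsub>F\<^esub> (t + w) = rels #>\<^bsub>F\<^esub> w" if t: "t \<in> rels" and w: "w \<in> carrier F" for t w
    using group.repr_independence[OF group_free_Abelian_group _ w subgroup_tensor_relations, of "t + w"] t
    by (auto simp: r_coset_def)
  have map: "tensor_map R Q ?N M (\<lambda>z. z) (tensor_relations R Q ?N #>\<^bsub>?F'\<^esub> w) = rels #>\<^bsub>F\<^esub> w"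
    if w: "w \<in> carrier ?F'" for w
  proof -
    have wF: "w \<in> carrier F" using w F'_sub by blast
    have "(\<Union>u\<in>tensor_relations R Q ?N #>\<^bsub>?F'\<^esub> w. rels #>\<^bsub>F\<^esub> u) = rels #>\<^bsub>F\<^esub> w"
      using absorb[OF rels'(1) wF] subgroup.one_closed[OF N.subgroup_tensor_relations]
      by (auto simp: r_coset_def)
    then show ?thesis by (simp only: tensor_map_def frag_extend_pair)
  qed
  have "pure_tensor R Q M q z \<in> tensor_map R Q ?N M (\<lambda>z. z) ` carrier (tensor_product R Q ?N)
      \<longleftrightarrow> (\<exists>w\<in>carrier ?F'. rels #>\<^bsub>F\<^esub> frag_of (q, z) = rels #>\<^bsub>F\<^esub> w)"
    unfolding pure_tensor_def tensor_product_def
    by (auto simp: FactGroup_def RCOSETS_def map image_iff)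
  also have "\<dots> \<longleftrightarrow> (\<exists>t\<in>rels. \<exists>w\<in>carrier ?F'. frag_of (q, z) = t + w)"
  proof
    assume "\<exists>w\<in>carrier ?F'. rels #>\<^bsub>F\<^esub> frag_of (q, z) = rels #>\<^bsub>F\<^esub> w"
    then obtain w where w: "w \<in> carrier ?F'" "rels #>\<^bsub>F\<^esub> frag_of (q, z) = rels #>\<^bsub>F\<^esub> w" by blast
    have "frag_of (q, z) \<in> rels #>\<^bsub>F\<^esub> frag_of (q, z)"
      by (rule group.rcos_self[OF group_free_Abelian_group _ subgroup_tensor_relations]) (use q z in simp)
    then have "frag_of (q, z) \<in> rels #>\<^bsub>F\<^esub> w" unfolding w(2) .
    then obtain t where "t \<in> rels" "frag_of (q, z) = t + w" by (auto simp: r_coset_def)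
    then show "\<exists>t\<in>rels. \<exists>w\<in>carrier ?F'. frag_of (q, z) = t + w"
      using w(1) by blast
  next
    assume "\<exists>t\<in>rels. \<exists>w\<in>carrier ?F'. frag_of (q, z) = t + w"
    then show "\<exists>w\<in>carrier ?F'. rels #>\<^bsub>F\<^esub> frag_of (q, z) = rels #>\<^bsub>F\<^esub> w"
      using absorb subsetD[OF F'_sub] by metis
  qed
  finally show ?thesis .
qed

end

section \<open>Ideal closures and \<open>tom\<close> of cyclic modules, with Q named
  \<open>M\<close>\<close>

context module
begin

text \<open>In one direction, (q, z) -> z q + J M kills both the relations and the formal sums over
  M x J. In the other, the q for which every (q, z) is a relation plus a sum over M x J form a
  submodule, and it contains J M by the balancing relation.\<close>

lemma ideal_closure_iff:
  assumes J: "ideal J R"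
  shows "ideal_closure R M J = {a \<in> carrier R. \<forall>x\<in>carrier M. a \<odot>\<^bsub>M\<^esub> x \<in> ideal_smult R J M}"
proof -
  interpret P: module_pair R M "regular_module R"
    by (intro module_pair.intro module_axioms R.module_regular)
  have J_sub: "J \<subseteq> carrier R" using J by (auto dest: ideal.Icarr)
  have J': "submodule J R (regular_module R)" using J by (simp add: R.submodule_regular_iff)
  define N where "N = ideal_smult R J M"
  have N: "submodule N R M" unfolding N_def by (rule ideal_smult_submodule[OF J_sub])
  let ?F' = "free_Abelian_group (carrier M \<times> J)"
  have "(\<exists>t\<in>P.rels. \<exists>w\<in>carrier ?F'. frag_of (x, a) = t + w) \<longleftrightarrow> a \<odot>\<^bsub>M\<^esub> x \<in> N"
    if a: "a \<in> carrier R" and x: "x \<in> carrier M" for a x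
  proof
    interpret N: abelian_subgroup N M by (rule submodule_abelian_subgroup[OF N])
    note G = N.a_factorgroup_is_comm_group
    obtain h where h: "group_hom P.F (M A_Mod N) h"
      and h_of: "\<And>q z. q \<in> carrier M \<Longrightarrow> z \<in> carrier (regular_module R)
          \<Longrightarrow> h (frag_of (q, z)) = N +>\<^bsub>M\<^esub> (z \<odot>\<^bsub>M\<^esub> q)"
      and h_rels: "\<And>w. w \<in> P.rels \<Longrightarrow> h w = \<one>\<^bsub>M A_Mod N\<^esub>"
      by (rule P.tensor_relations_hom[OF G, of "\<lambda>q z. N +>\<^bsub>M\<^esub> (z \<odot>\<^bsub>M\<^esub> q)"])
        (simp_all add: A_FactGroup_def' coset_mem_rcosets[OF N] coset_add[OF N] smult_l_distr
          smult_r_distr smult_assoc1[symmetric] R.m_comm)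
    interpret h: group_hom P.F "M A_Mod N" h by (rule h)
    have one: "\<one>\<^bsub>M A_Mod N\<^esub> = N" by (simp add: A_FactGroup_def')
    have ker: "subgroup (kernel P.F (M A_Mod N) h) P.F" by (rule h.subgroup_kernel)
    \<comment> \<open>It suffices to check generators: (q, j) with j in J goes to the coset of j q,
      which is trivial.\<close>
    have h_F': "h w = N" if "w \<in> carrier ?F'" for w
    proof (rule free_Abelian_group_induct[where x = w and S = "carrier M \<times> J" and P = "\<lambda>w. h w = N"])
      show "Poly_Mapping.keys w \<subseteq> carrier M \<times> J" using that by simp
      show "h 0 = N" using h.hom_one by (simp add: one)
      show "h (u - v) = N" if "Poly_Mapping.keys u \<subseteq> carrier M \<times> J" "Poly_Mapping.keys v \<subseteq> carrier M \<times> J"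
        and N: "h u = N" "h v = N" for u v
      proof -
        have "carrier M \<times> J \<subseteq> carrier M \<times> carrier R" using J_sub by blast
        then have F: "u \<in> carrier P.F" "v \<in> carrier P.F"
          using that(1,2) by (simp_all add: subset_trans)
        have "h (u - v) = h u \<otimes>\<^bsub>M A_Mod N\<^esub> inv\<^bsub>M A_Mod N\<^esub> (h v)"
          using h.hom_mult[of u "- v"] h.hom_inv[of v] F by simp
        then show ?thesis
          using N h.H.r_inv[OF h.H.one_closed] by (simp only: one)
      qed
      show "h (frag_of p) = N" if p: "p \<in> carrier M \<times> J" for p
      proof -
        obtain q j where p: "p = (q, j)" "q \<in> carrier M" "j \<in> J" using p by blast
        then have "j \<odot>\<^bsub>M\<^esub> q \<in> N" unfolding N_def by (intro ideal_smultI)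
        moreover have "j \<in> carrier R" using p J_sub by blast
        ultimately show ?thesis
          using h_of[of q j] p coset_eq_submodule_iff[OF N, of "j \<odot>\<^bsub>M\<^esub> q"] by simp
      qed
    qed
    assume "\<exists>t\<in>P.rels. \<exists>w\<in>carrier ?F'. frag_of (x, a) = t + w"
    then obtain t w where t: "t \<in> P.rels" and w: "w \<in> carrier ?F'" and eq: "frag_of (x, a) = t + w"
      by blast
    have "carrier M \<times> J \<subseteq> carrier M \<times> carrier R" using J_sub by blast
    then have wF: "w \<in> carrier P.F" using w by (simp add: subset_trans)
    have tF: "t \<in> carrier P.F" using t subgroup.subset[OF P.subgroup_tensor_relations] by blast
    have "h (frag_of (x, a)) = \<one>\<^bsub>M A_Mod N\<^esub> \<otimes>\<^bsub>M A_Mod N\<^esub> \<one>\<^bsub>M A_Mod N\<^esub>"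
      using h.hom_mult[OF tF wF] h_rels[OF t] h_F'[OF w] unfolding eq one by simp
    then have "N +>\<^bsub>M\<^esub> (a \<odot>\<^bsub>M\<^esub> x) = N"
      using h_of[OF x, of a] a h.H.l_one[OF h.H.one_closed] unfolding one by simp
    then show "a \<odot>\<^bsub>M\<^esub> x \<in> N" using coset_eq_submodule_iff[OF N] a x by simp
  next
    let ?H = "{t + w | t w. t \<in> P.rels \<and> w \<in> carrier ?F'}"
    let ?S = "{q \<in> carrier M. \<forall>z\<in>carrier (regular_module R). frag_of (q, z) \<in> ?H}"
    have rels0: "0 \<in> P.rels" using subgroup.one_closed[OF P.subgroup_tensor_relations] by simp
    have S: "submodule ?S R M"
    proof (rule P.tensor_null_submodule)
      show "P.rels \<subseteq> ?H"
      proof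
        fix t assume "t \<in> P.rels"
        then have "t = t + 0 \<and> t \<in> P.rels \<and> 0 \<in> carrier ?F'" by simp
        then show "t \<in> ?H" by blast
      qed
      fix u v assume "u \<in> ?H" "v \<in> ?H"
      then obtain t w t' w' where u: "u = t + w" "t \<in> P.rels" "w \<in> carrier ?F'"
        and v: "v = t' + w'" "t' \<in> P.rels" "w' \<in> carrier ?F'" by blast
      have "u - v = (t - t') + (w - w')" using u v by simp
      moreover have "w - w' \<in> carrier ?F'" using keys_diff[of w w'] u v by auto
      ultimately show "u - v \<in> ?H" using P.tensor_relations_diff[OF u(2) v(2)] by blast
    qed
    have "N \<subseteq> ?S"
      unfolding N_def
    proof (rule ideal_smult_minimal[OF S])
      fix j q assume j: "j \<in> J" and q: "q \<in> carrier M"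
      then have jc: "j \<in> carrier R" using J_sub by blast
      have "frag_of (j \<odot>\<^bsub>M\<^esub> q, z) \<in> ?H" if z: "z \<in> carrier R" for z
      proof -
        have "frag_of (j \<odot>\<^bsub>M\<^esub> q, z) - frag_of (q, j \<otimes> z) \<in> P.rels"
          using P.tensor_relations_incl(3)[OF jc q, of z] z by simp
        moreover have "j \<otimes> z \<in> J" using ideal.I_r_closed[OF J j z] .
        then have "frag_of (q, j \<otimes> z) \<in> carrier ?F'" using q by simp
        ultimately have "(frag_of (j \<odot>\<^bsub>M\<^esub> q, z) - frag_of (q, j \<otimes> z)) + frag_of (q, j \<otimes> z) \<in> ?H"
          by blast
        then show ?thesis by simp
      qed
      then show "j \<odot>\<^bsub>M\<^esub> q \<in> ?S" using jc q by simp
    qed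
    moreover assume "a \<odot>\<^bsub>M\<^esub> x \<in> N"
    \<comment> \<open>Evaluate at second component 1: the balancing relation then exchanges (a x, 1)
      for (x, a).\<close>
    ultimately have "frag_of (a \<odot>\<^bsub>M\<^esub> x, \<one>) \<in> ?H" by auto
    then obtain t w where tw: "t \<in> P.rels" "w \<in> carrier ?F'" "frag_of (a \<odot>\<^bsub>M\<^esub> x, \<one>) = t + w"
      by blast
    have "frag_of (a \<odot>\<^bsub>M\<^esub> x, \<one>) - frag_of (x, a) \<in> P.rels"
      using P.tensor_relations_incl(3)[OF a x, of \<one>] a by simp
    from P.tensor_relations_diff[OF tw(1) this] have "frag_of (x, a) - w \<in> P.rels"
      unfolding tw(3) by (simp add: algebra_simps)
    moreover have "frag_of (x, a) = (frag_of (x, a) - w) + w" by simp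
    ultimately show "\<exists>t\<in>P.rels. \<exists>w\<in>carrier ?F'. frag_of (x, a) = t + w" using tw(2) by blast
  qed
  then show ?thesis
    unfolding ideal_closure_def module_closure_def N_def
    using P.pure_tensor_in_image_iff[OF J'] by auto
qed

text \<open>The tensor of x with a + J vanishes exactly when a x lies in J M, reflecting that the
  tensor product of M with R/J is M/JM. Hence \<open>tom\<close> of R/J is J^cl/J, written as a set
  of cosets.\<close>

lemma tom_cyclic_module:
  assumes J: "ideal J R"
  shows "tom R M (cyclic_module R J) = (\<lambda>a. J +>\<^bsub>R\<^esub> a) ` ideal_closure R M J"
proof -
  interpret reg: module R "regular_module R" by (rule R.module_regular)
  have J_sub: "J \<subseteq> carrier R" using J by (auto dest: ideal.Icarr)
  have J': "submodule J R (regular_module R)" using J by (simp add: R.submodule_regular_iff)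
  let ?C = "cyclic_module R J"
  interpret P: module_pair R M ?C
    unfolding cyclic_module_def
    by (intro module_pair.intro module_axioms reg.quotient_module_is_module[OF J'])
  have smult: "r \<odot>\<^bsub>?C\<^esub> (J +>\<^bsub>R\<^esub> a) = J +>\<^bsub>R\<^esub> (r \<otimes> a)" if "r \<in> carrier R" "a \<in> carrier R" for r a
    using reg.smult_coset[OF J', of a r] that by (simp add: cyclic_module_def)
  have add: "(J +>\<^bsub>R\<^esub> a) \<oplus>\<^bsub>?C\<^esub> (J +>\<^bsub>R\<^esub> b) = J +>\<^bsub>R\<^esub> (a \<oplus> b)" if "a \<in> carrier R" "b \<in> carrier R" for a b
    using reg.coset_add[OF J', of a b] that by (simp add: cyclic_module_def)
  have carr: "X \<in> carrier ?C \<longleftrightarrow> (\<exists>a\<in>carrier R. X = J +>\<^bsub>R\<^esub> a)" for X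
    by (auto simp: cyclic_module_def A_RCOSETS_def')
  define N where "N = ideal_smult R J M"
  have N: "submodule N R M" unfolding N_def by (rule ideal_smult_submodule[OF J_sub])
  have key: "frag_of (x, J +>\<^bsub>R\<^esub> a) \<in> P.rels \<longleftrightarrow> a \<odot>\<^bsub>M\<^esub> x \<in> N"
    if a: "a \<in> carrier R" and x: "x \<in> carrier M" for a x
  proof
    interpret N: abelian_subgroup N M by (rule submodule_abelian_subgroup[OF N])
    note G = N.a_factorgroup_is_comm_group
    \<comment> \<open>Changing the representative z by j in J changes z q by j q in J M, so the
      union is a single coset of N.\<close>
    define f where "f q X = (\<Union>z\<in>X. N +>\<^bsub>M\<^esub> (z \<odot>\<^bsub>M\<^esub> q))" for q X
    have f: "f q (J +>\<^bsub>R\<^esub> z) = N +>\<^bsub>M\<^esub> (z \<odot>\<^bsub>M\<^esub> q)" if "q \<in> carrier M" "z \<in> carrier R" for q z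
    proof -
      have "N +>\<^bsub>M\<^esub> ((j \<oplus> z) \<odot>\<^bsub>M\<^esub> q) = N +>\<^bsub>M\<^esub> (z \<odot>\<^bsub>M\<^esub> q)" if j: "j \<in> J" for j
      proof -
        have "j \<in> carrier R" using j J_sub by blast
        moreover have "j \<odot>\<^bsub>M\<^esub> q \<in> N" unfolding N_def by (rule ideal_smultI[OF j \<open>q \<in> carrier M\<close>])
        ultimately show ?thesis
          using coset_absorb[OF N, of "j \<odot>\<^bsub>M\<^esub> q" "z \<odot>\<^bsub>M\<^esub> q"] \<open>q \<in> carrier M\<close> \<open>z \<in> carrier R\<close>
          by (simp add: smult_l_distr)
      qed
      then show ?thesis
        unfolding f_def using reg.coset_UN[OF J', of z "\<lambda>z. N +>\<^bsub>M\<^esub> (z \<odot>\<^bsub>M\<^esub> q)"] that by simp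
    qed
    obtain h where h_of: "\<And>q X. q \<in> carrier M \<Longrightarrow> X \<in> carrier ?C \<Longrightarrow> h (frag_of (q, X)) = f q X"
      and h_rels: "\<And>w. w \<in> P.rels \<Longrightarrow> h w = \<one>\<^bsub>M A_Mod N\<^esub>"
    proof (rule P.tensor_relations_hom[OF G, of f])
      show "f q X \<in> carrier (M A_Mod N)" if "q \<in> carrier M" "X \<in> carrier ?C" for q X
        using that by (auto simp: carr f A_FactGroup_def' coset_mem_rcosets[OF N])
      show "f (p \<oplus>\<^bsub>M\<^esub> q) X = f p X \<otimes>\<^bsub>M A_Mod N\<^esub> f q X"
        if "p \<in> carrier M" "q \<in> carrier M" "X \<in> carrier ?C" for p q X
        using that by (auto simp: carr f coset_add[OF N] smult_r_distr)
      show "f q (X \<oplus>\<^bsub>?C\<^esub> Y) = f q X \<otimes>\<^bsub>M A_Mod N\<^esub> f q Y"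
        if "q \<in> carrier M" "X \<in> carrier ?C" "Y \<in> carrier ?C" for q X Y
        using that by (auto simp: carr f add coset_add[OF N] smult_l_distr)
      show "f (r \<odot>\<^bsub>M\<^esub> q) X = f q (r \<odot>\<^bsub>?C\<^esub> X)"
        if "r \<in> carrier R" "q \<in> carrier M" "X \<in> carrier ?C" for r q X
        using that by (auto simp: carr f smult smult_assoc1[symmetric] R.m_comm)
    qed blast
    assume "frag_of (x, J +>\<^bsub>R\<^esub> a) \<in> P.rels"
    then have "f x (J +>\<^bsub>R\<^esub> a) = N"
      using h_rels h_of[OF x, of "J +>\<^bsub>R\<^esub> a"] a by (auto simp: carr A_FactGroup_def')
    then show "a \<odot>\<^bsub>M\<^esub> x \<in> N" using f[OF x a] coset_eq_submodule_iff[OF N] a x by simp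
  next
    let ?S = "{q \<in> carrier M. \<forall>X\<in>carrier ?C. frag_of (q, X) \<in> P.rels}"
    have S: "submodule ?S R M"
      by (rule P.tensor_null_submodule) (simp_all add: P.tensor_relations_diff)
    have "N \<subseteq> ?S"
      unfolding N_def
    proof (rule ideal_smult_minimal[OF S])
      fix j q assume j: "j \<in> J" and q: "q \<in> carrier M"
      then have jc: "j \<in> carrier R" using J_sub by blast
      have "frag_of (j \<odot>\<^bsub>M\<^esub> q, X) \<in> P.rels" if X: "X \<in> carrier ?C" for X
      proof -
        obtain z where z: "z \<in> carrier R" "X = J +>\<^bsub>R\<^esub> z" using X by (auto simp: carr)
        have "j \<otimes> z \<in> J" using ideal.I_r_closed[OF J j z(1)] .
        \<comment> \<open>J annihilates R/J, so balancing moves j to the right factor and leaves a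
          pair with zero, which is a relation.\<close>
        then have "j \<odot>\<^bsub>?C\<^esub> X = \<zero>\<^bsub>?C\<^esub>"
          using reg.coset_eq_submodule_iff[OF J', of "j \<otimes> z"] smult[OF jc z(1)] jc z
          by (simp add: cyclic_module_def)
        then have "frag_of (q, j \<odot>\<^bsub>?C\<^esub> X) \<in> P.rels"
          using P.frag_of_zero_right[OF q] by simp
        moreover have "- frag_of (q, j \<odot>\<^bsub>?C\<^esub> X) \<in> P.rels"
          using P.tensor_relations_diff[OF _ calculation, of 0]
            subgroup.one_closed[OF P.subgroup_tensor_relations] by simp
        ultimately show ?thesis
          using P.tensor_relations_diff[OF P.tensor_relations_incl(3)[OF jc q X], of "- frag_of (q, j \<odot>\<^bsub>?C\<^esub> X)"]
          by simp
      qed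
      then show "j \<odot>\<^bsub>M\<^esub> q \<in> ?S" using jc q by simp
    qed
    moreover assume "a \<odot>\<^bsub>M\<^esub> x \<in> N"
    moreover have one: "J +>\<^bsub>R\<^esub> \<one> \<in> carrier ?C" by (auto simp: carr)
    ultimately have "frag_of (a \<odot>\<^bsub>M\<^esub> x, J +>\<^bsub>R\<^esub> \<one>) \<in> P.rels" by blast
    from P.tensor_relations_diff[OF this P.tensor_relations_incl(3)[OF a x one]]
    show "frag_of (x, J +>\<^bsub>R\<^esub> a) \<in> P.rels" using smult[OF a R.one_closed] a by simp
  qed
  define T where "T X \<longleftrightarrow> (\<forall>x\<in>carrier M. pure_tensor R M ?C x X = \<one>\<^bsub>tensor_product R M ?C\<^esub>)" for X
  have T: "T (J +>\<^bsub>R\<^esub> a) \<longleftrightarrow> a \<in> ideal_closure R M J" if a: "a \<in> carrier R" for a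
  proof -
    have "J +>\<^bsub>R\<^esub> a \<in> carrier ?C" using a carr by blast
    then show ?thesis
      using a key P.pure_tensor_eq_one_iff by (simp add: T_def ideal_closure_iff[OF J] N_def)
  qed
  have "ideal_closure R M J \<subseteq> carrier R" by (auto simp: ideal_closure_iff[OF J])
  moreover have "tom R M ?C = {X \<in> carrier ?C. T X}" by (simp add: tom_def T_def)
  ultimately show ?thesis using T by (auto simp: carr)
qed

text \<open>Because \<open>tom\<close> of R/J is J^cl/J, an element r annihilates it exactly when r
  J^cl lies in J.\<close>

lemma annihilator_tom_cyclic_module:
  assumes J: "ideal J R"
  shows "module_annihilator R (cyclic_module R J) (tom R M (cyclic_module R J))
    = colon R J (ideal_closure R M J)"
proof -
  interpret reg: module R "regular_module R" by (rule R.module_regular)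
  have J': "submodule J R (regular_module R)" using J by (simp add: R.submodule_regular_iff)
  have cl: "a \<in> carrier R" if "a \<in> ideal_closure R M J" for a
    using that by (simp add: ideal_closure_iff[OF J])
  have "r \<odot>\<^bsub>cyclic_module R J\<^esub> (J +>\<^bsub>R\<^esub> a) = \<zero>\<^bsub>cyclic_module R J\<^esub> \<longleftrightarrow> r \<otimes> a \<in> J"
    if "r \<in> carrier R" "a \<in> carrier R" for r a
    using reg.smult_coset[OF J', of a r] reg.coset_eq_submodule_iff[OF J', of "r \<otimes> a"] that
    by (simp add: cyclic_module_def)
  then show ?thesis
    unfolding module_annihilator_def colon_def tom_cyclic_module[OF J] using cl by auto
qed

end

section \<open>Primary ideals and quotients of finite length\<close>

context noetherian_local_ring
begin

lemma ideal_set_add_upper: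
  assumes "ideal I R" "ideal J R"
  shows "I \<subseteq> I <+>\<^bsub>R\<^esub> J" "J \<subseteq> I <+>\<^bsub>R\<^esub> J"
proof -
  interpret reg: module R "regular_module R" by (rule module_regular)
  show "I \<subseteq> I <+>\<^bsub>R\<^esub> J" "J \<subseteq> I <+>\<^bsub>R\<^esub> J"
    using reg.set_add_upper[of I J] assms by (simp_all add: submodule_regular_iff)
qed

lemma ideal_set_add_least:
  assumes "ideal K R" "I \<subseteq> K" "J \<subseteq> K"
  shows "I <+>\<^bsub>R\<^esub> J \<subseteq> K"
proof
  fix z assume "z \<in> I <+>\<^bsub>R\<^esub> J"
  then obtain x y where "x \<in> I" "y \<in> J" "z = x \<oplus> y" by (rule set_addE)
  then show "z \<in> K"
    using assms additive_subgroup.a_closed[OF ideal.axioms(1)[OF assms(1)]] by blast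
qed

text \<open>Once the radical is \<open>\<mm>\<close>, an element b outside the radical is a unit,
  and a b in I can be multiplied by its inverse.\<close>

lemma primary_to_max_if_mpow_le:
  assumes "ideal I R" "I \<noteq> carrier R" "mpow n \<subseteq> I"
  shows "primary_to R \<mm> I"
proof -
  have I: "I \<subseteq> \<mm>" by (rule proper_ideal_le_max[OF assms(1,2)])
  have rad: "radical_of R I = \<mm>"
  proof
    show "\<mm> \<subseteq> radical_of R I"
      using pow_mem_mpow assms(3) Icarr by (auto simp: radical_of_def)
    show "radical_of R I \<subseteq> \<mm>"
    proof
      fix a assume "a \<in> radical_of R I"
      then obtain k :: nat where a: "a \<in> carrier R" "a [^] k \<in> \<mm>"
        using I by (auto simp: radical_of_def)
      then have "a [^] k \<notin> Units R" using Units_iff_notin_max[of "a [^] k"] by simp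
      then have "a \<notin> Units R" using Units_pow_closed by blast
      then show "a \<in> \<mm>" using Units_iff_notin_max[OF a(1)] by simp
    qed
  qed
  have "a \<in> I \<or> b \<in> \<mm>" if ab: "a \<in> carrier R" "b \<in> carrier R" "a \<otimes> b \<in> I" for a b
  proof (cases "b \<in> \<mm>")
    case False
    then have b: "b \<in> Units R" using ab(2) Units_iff_notin_max by simp
    then have "(a \<otimes> b) \<otimes> inv b \<in> I" by (intro ideal.I_r_closed[OF assms(1) ab(3)]) simp
    then show ?thesis using b ab by (simp add: m_assoc)
  qed simp
  with assms(1,2) show ?thesis
    unfolding primary_to_def primary_ideal_def rad by (intro conjI ballI impI refl)
qed

lemma mpow_le_if_primary_to_max:
  assumes "primary_to R \<mm> I"
  shows "\<exists>n. mpow n \<subseteq> I"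
  using assms by (intro mpow_le_of_radical) (auto simp: primary_to_def primary_ideal_def radical_of_def)

text \<open>Noetherian induction: if I is proper, there is x outside I with \<open>\<mm>\<close> x
  <= I, so (I + (x))/I is simple. Any chain above I can be reshaped into a chain above I + (x) that
  is shorter by only one step, so the bound grows by 1.\<close>

lemma bounded_ideal_chains:
  assumes "ideal I R" "mpow n \<subseteq> I"
  shows "\<exists>b. \<forall>l N. (\<forall>i\<le>l. ideal (N i) R \<and> I \<subseteq> N i) \<longrightarrow> (\<forall>i<l. N i \<subset> N (Suc i)) \<longrightarrow> l \<le> b"
  using assms
proof (induction I rule: ideal_noetherian_induct)
  case (ideal I)
  show ?case
  proof (cases "I = carrier R")
    case True
    have "l \<le> 0" if "\<forall>i\<le>l. ideal (N i) R \<and> I \<subseteq> N i" "\<forall>i<l. N i \<subset> N (Suc i)" for l :: nat and N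
    proof (rule ccontr)
      assume "\<not> l \<le> 0"
      then have "N 0 \<subset> N (Suc 0)" "I \<subseteq> N 0" "ideal (N (Suc 0)) R" using that by auto
      then show False using True ideal_carr by blast
    qed
    then show ?thesis by (intro exI[of _ 0] allI impI)
  next
    case False
    \<comment> \<open>Minimality of k supplies x in \<open>\<mm>\<close>^(k-1) outside I, and then
      \<open>\<mm>\<close> x <= \<open>\<mm>\<close>^k <= I. Here k > 0 because I is proper.\<close>
    define k where "k = (LEAST k. mpow k \<subseteq> I)"
    have k: "mpow k \<subseteq> I" unfolding k_def using ideal.prems by (rule LeastI)
    have "k \<noteq> 0" using k False ideal_carr[OF ideal.hyps] by (cases k) auto
    then obtain j where j: "k = Suc j" using not0_implies_Suc by blast
    then have "\<not> mpow j \<subseteq> I" using not_less_Least[of j "\<lambda>k. mpow k \<subseteq> I"] k_def by simp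
    then obtain x where x: "x \<in> mpow j" "x \<notin> I" by blast
    have xc: "x \<in> carrier R" using x(1) mpow_carr by blast
    have mx: "r \<otimes> x \<in> I" if "r \<in> \<mm>" for r
    proof -
      have "x \<otimes> r \<in> mpow k" using ideal_prod.prod[OF x(1) that] by (simp add: j)
      then show ?thesis using k xc Icarr[OF that] m_comm[of x r] by auto
    qed
    have P: "ideal (PIdl x) R" by (rule cgenideal_ideal[OF xc])
    have xP: "x \<in> PIdl x" by (rule cgenideal_self[OF xc])
    let ?I = "I <+>\<^bsub>R\<^esub> PIdl x"
    have I': "ideal ?I R" by (rule add_ideals[OF ideal.hyps P])
    have "I \<subset> ?I" using ideal_set_add_upper[OF ideal.hyps P] xP x(2) by blast
    moreover from this have "mpow n \<subseteq> ?I" using ideal.prems by (meson psubset_imp_subset subset_trans)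
    ultimately obtain b where b: "\<forall>l N. (\<forall>i\<le>l. ideal (N i) R \<and> ?I \<subseteq> N i) \<longrightarrow> (\<forall>i<l. N i \<subset> N (Suc i)) \<longrightarrow> l \<le> b"
      using ideal.IH[OF I'] by (elim exE meta_impE) assumption+
    have "l \<le> Suc b"
      if N: "\<forall>i\<le>l. ideal (N i) R \<and> I \<subseteq> N i" "\<forall>i<l. N i \<subset> N (Suc i)" for l N
    proof (cases l)
      case (Suc l')
      \<comment> \<open>The new chain adds x to each member until the next one contains x by itself;
        from there on it is the old chain shifted by one. The shift is what costs one step.\<close>
      define L where "L i = (if x \<in> N (Suc i) then N (Suc i) else N i <+>\<^bsub>R\<^esub> PIdl x)" for i
      have ideals: "ideal (N i) R" "I \<subseteq> N i" if "i \<le> l" for i using N(1) that by auto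
      have "l' \<le> b"
      proof (rule b[THEN spec, THEN spec, THEN mp, THEN mp])
        show "\<forall>i\<le>l'. ideal (L i) R \<and> ?I \<subseteq> L i"
        proof (intro allI impI)
          fix i assume "i \<le> l'"
          then have i: "ideal (N i) R" "I \<subseteq> N i" "ideal (N (Suc i)) R" "I \<subseteq> N (Suc i)"
            using ideals Suc by auto
          have L: "ideal (L i) R" using i add_ideals[OF i(1) P] by (simp add: L_def)
          have "I \<subseteq> L i" "x \<in> L i"
            using i ideal_set_add_upper[OF i(1) P] xP by (auto simp: L_def)
          then have "?I \<subseteq> L i"
            by (intro ideal_set_add_least[OF L] cgenideal_minimal[OF L])
          then show "ideal (L i) R \<and> ?I \<subseteq> L i" using L by blast
        qed
        show "\<forall>i<l'. L i \<subset> L (Suc i)"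
        proof (intro allI impI)
          fix i assume "i < l'"
          then have i: "ideal (N i) R" "I \<subseteq> N i" "ideal (N (Suc i)) R" "ideal (N (Suc (Suc i))) R"
            and lt: "N i \<subset> N (Suc i)" "N (Suc i) \<subset> N (Suc (Suc i))"
            using ideals N(2) Suc by auto
          show "L i \<subset> L (Suc i)"
          proof (cases "x \<in> N (Suc i)")
            case True
            then show ?thesis using lt by (auto simp: L_def)
          next
            case False
            have L': "ideal (L (Suc i)) R" using i add_ideals[OF i(3) P] by (simp add: L_def)
            have up: "N (Suc i) \<subseteq> L (Suc i)" "x \<in> L (Suc i)"
              using lt ideal_set_add_upper[OF i(3) P] xP by (auto simp: L_def)
            have "N i <+>\<^bsub>R\<^esub> PIdl x \<subseteq> L (Suc i)"
              using up lt by (intro ideal_set_add_least[OF L'] cgenideal_minimal[OF L']) auto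
            then have le: "L i \<subseteq> L (Suc i)" using False by (simp add: L_def)
            \<comment> \<open>This y witnesses strictness. If y = z + r x with z in N i, then r in
              \<open>\<mm>\<close> would put r x into I and y into N i, while a unit r would put x
              into N (i+1).\<close>
            obtain y where y: "y \<in> N (Suc i)" "y \<notin> N i" using lt by blast
            have "y \<notin> L i"
            proof
              assume "y \<in> L i"
              then have "y \<in> N i <+>\<^bsub>R\<^esub> PIdl x" using False by (simp add: L_def)
              then obtain z r where z: "z \<in> N i" and r: "r \<in> carrier R" and eq: "y = z \<oplus> r \<otimes> x"
                by (auto elim!: set_addE simp: cgenideal_def)
              show False
              proof (cases "r \<in> \<mm>")
                case True
                then have "r \<otimes> x \<in> N i" using mx i(2) by blast
                then show False
                  using y(2) z eq additive_subgroup.a_closed[OF ideal.axioms(1)[OF i(1)]] by blast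
              next
                case False
                then have ru: "r \<in> Units R" using Units_iff_notin_max[OF r] by simp
                interpret reg: module R "regular_module R" by (rule module_regular)
                have "r \<otimes> x \<in> N (Suc i)"
                  using reg.submodule_add_cancel[of "N (Suc i)" z "r \<otimes> x"] i(3) z lt y(1) eq r xc
                  by (auto simp: submodule_regular_iff)
                then have "inv r \<otimes> (r \<otimes> x) \<in> N (Suc i)"
                  by (rule ideal.I_l_closed[OF i(3)]) (use ru in simp)
                then have "x \<in> N (Suc i)" using ru r xc by (simp add: m_assoc[symmetric])
                then show False using \<open>x \<notin> N (Suc i)\<close> by blast
              qed
            qed
            then show ?thesis using le up(1) y(1) by blast
          qed
        qed
      qed
      then show ?thesis using Suc by simp
    qed simp
    then show ?thesis by (intro exI[of _ "Suc b"] allI impI)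
  qed
qed

text \<open>Preimages under R -> R/I turn a strict chain of submodules into a strict chain of ideals
  above I, so the bound for ideals bounds the supremum.\<close>

lemma finite_length_if_mpow_le:
  assumes I: "ideal I R" and "mpow n \<subseteq> I"
  shows "module_length R (cyclic_module R I) < \<infinity>"
proof -
  interpret reg: module R "regular_module R" by (rule module_regular)
  have I': "submodule I R (regular_module R)" using I by (simp add: submodule_regular_iff)
  obtain b where b: "\<forall>l N. (\<forall>i\<le>l. ideal (N i) R \<and> I \<subseteq> N i) \<longrightarrow> (\<forall>i<l. N i \<subset> N (Suc i)) \<longrightarrow> l \<le> b"
    using bounded_ideal_chains[OF assms] by (rule exE)
  have "module_length R (cyclic_module R I) \<le> enat b"
    unfolding module_length_def
  proof (rule Sup_least)
    fix e
    assume "e \<in> {enat n |n. \<exists>N. (\<forall>i\<le>n. submodule (N i) R (cyclic_module R I)) \<and> (\<forall>i<n. N i \<subset> N (Suc i))}"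
    then obtain l N where e: "e = enat l" and N: "\<And>i. i \<le> l \<Longrightarrow> submodule (N i) R (cyclic_module R I)"
      and lt: "\<And>i. i < l \<Longrightarrow> N i \<subset> N (Suc i)" by blast
    define P where "P i = {x \<in> carrier R. I +>\<^bsub>R\<^esub> x \<in> N i}" for i
    have "l \<le> b"
    proof (rule b[THEN spec, THEN spec, THEN mp, THEN mp])
      show "\<forall>i\<le>l. ideal (P i) R \<and> I \<subseteq> P i"
        using reg.submodule_quotient_preimage[OF I'] N
        by (simp add: P_def submodule_regular_iff cyclic_module_def)
      show "\<forall>i<l. P i \<subset> P (Suc i)"
      proof (intro allI impI)
        fix i assume i: "i < l"
        obtain X where X: "X \<in> N (Suc i)" "X \<notin> N i" using lt[OF i] by blast
        have "N (Suc i) \<subseteq> carrier (cyclic_module R I)"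
          using subgroup.subset[OF submodule.axioms(1)[OF N[of "Suc i"]]] i by simp
        then obtain x where "x \<in> carrier R" "X = I +>\<^bsub>R\<^esub> x"
          using X(1) by (auto simp: cyclic_module_def A_RCOSETS_def')
        then have "x \<in> P (Suc i)" "x \<notin> P i" using X by (auto simp: P_def)
        moreover have "P i \<subseteq> P (Suc i)" using lt[OF i] by (auto simp: P_def)
        ultimately show "P i \<subset> P (Suc i)" by blast
      qed
    qed
    then show "e \<le> enat b" using e by simp
  qed
  then show ?thesis by (rule le_less_trans) simp
qed

end

section \<open>Closures as intersections over primary ideals\<close>

text \<open>The assumption says that the intersection of all J Q + \<open>\<mm>\<close>^n Q lies in
  J Q. Separated quotients yield it through \<open>adically_separated_quotientD\<close> and finite
  generation through \<open>Krull_intersection\<close>, so both cases share one argument.\<close>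

locale separated_module = noetherian_local_ring \<mm> R + module R Q
  for \<mm> and R (structure) and Q +
  assumes separated: "\<lbrakk>ideal J R; x \<in> carrier Q; \<And>n. x \<in> ideal_smult R J Q <+>\<^bsub>Q\<^esub> ideal_smult R (mpow n) Q\<rbrakk>
    \<Longrightarrow> x \<in> ideal_smult R J Q"
begin

lemma ideal_closure_mono:
  assumes "ideal I R" "ideal J R" "I \<subseteq> J"
  shows "ideal_closure R Q I \<subseteq> ideal_closure R Q J"
  using ideal_smult_mono[OF assms(3) ideal_carr[OF assms(2)]]
  by (auto simp: ideal_closure_iff assms(1,2))

lemma closure_eq_Inter_primary:
  assumes J: "ideal J R"
  shows "\<exists>\<I>. (\<forall>I\<in>\<I>. primary_to R \<mm> I) \<and> J = carrier R \<inter> (\<Inter>I\<in>\<I>. I) \<and>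
    ideal_closure R Q J = carrier R \<inter> (\<Inter>I\<in>\<I>. ideal_closure R Q I)"
proof (cases "J = carrier R")
  \<comment> \<open>An \<open>\<mm>\<close>-primary ideal is proper, so J = R is realised by the
    empty family; intersecting with \<open>carrier R\<close> gives that family the intersection
    R.\<close>
  case True
  have "a \<odot>\<^bsub>Q\<^esub> x \<in> ideal_smult R J Q" if "a \<in> carrier R" "x \<in> carrier Q" for a x
    using that True by (intro ideal_smultI) auto
  then have "ideal_closure R Q J = carrier R" by (auto simp: ideal_closure_iff[OF J])
  then show ?thesis using True by (intro exI[of _ "{}"]) simp
next
  case False
  \<comment> \<open>The successor keeps each I n inside \<open>\<mm>\<close>, hence proper. The
    inclusion \<open>dec\<close> below returns to exponent n where Krull's theorem and
    \<open>separated\<close> ask for all n, including 0.\<close>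
  define I where "I n = J <+>\<^bsub>R\<^esub> mpow (Suc n)" for n
  have I: "ideal (I n) R" for n unfolding I_def by (intro add_ideals J mpow_ideal)
  have mpow_I: "mpow (Suc n) \<subseteq> I n" and J_I: "J \<subseteq> I n" for n
    unfolding I_def by (rule ideal_set_add_upper[OF J mpow_ideal])+
  have "I n \<subseteq> \<mm>" for n
    unfolding I_def
    by (rule ideal_set_add_least[OF max_ideal proper_ideal_le_max[OF J False] mpow_Suc_le_max])
  then have "I n \<noteq> carrier R" for n using one_notin_max one_closed by blast
  then have primary: "primary_to R \<mm> (I n)" for n
    using primary_to_max_if_mpow_le[OF I _ mpow_I] by blast
  have dec: "mpow (Suc n) \<subseteq> mpow n" for n
    using ideal_prod_inter[OF mpow_ideal max_ideal, of n] by auto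
  have inter: "J = carrier R \<inter> (\<Inter>I\<in>range I. I)"
  proof
    show "J \<subseteq> carrier R \<inter> (\<Inter>I\<in>range I. I)" using J_I ideal_carr[OF J] by blast
    show "carrier R \<inter> (\<Inter>I\<in>range I. I) \<subseteq> J"
    proof
      fix x assume x: "x \<in> carrier R \<inter> (\<Inter>I\<in>range I. I)"
      have "x \<in> J <+>\<^bsub>R\<^esub> mpow n" for n
      proof -
        have "x \<in> I n" using x by blast
        then show ?thesis using dec[of n] by (auto simp: I_def elim!: set_addE intro!: set_addI)
      qed
      then show "x \<in> J" using ideal_Krull_intersection[OF J, of x] x by blast
    qed
  qed
  have "ideal_closure R Q J = carrier R \<inter> (\<Inter>I\<in>range I. ideal_closure R Q I)"
  proof
    show "ideal_closure R Q J \<subseteq> carrier R \<inter> (\<Inter>I\<in>range I. ideal_closure R Q I)"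
      using ideal_closure_mono[OF J I J_I] by (auto simp: ideal_closure_iff[OF J])
    show "carrier R \<inter> (\<Inter>I\<in>range I. ideal_closure R Q I) \<subseteq> ideal_closure R Q J"
    proof
      fix a assume a: "a \<in> carrier R \<inter> (\<Inter>I\<in>range I. ideal_closure R Q I)"
      have "a \<odot>\<^bsub>Q\<^esub> x \<in> ideal_smult R J Q" if x: "x \<in> carrier Q" for x
      proof (rule separated[OF J])
        show "a \<odot>\<^bsub>Q\<^esub> x \<in> carrier Q" using a x by simp
        fix n
        have "a \<in> ideal_closure R Q (I n)" using a by blast
        then have "a \<odot>\<^bsub>Q\<^esub> x \<in> ideal_smult R (I n) Q" using x by (simp add: ideal_closure_iff[OF I])
        then have "a \<odot>\<^bsub>Q\<^esub> x \<in> ideal_smult R J Q <+>\<^bsub>Q\<^esub> ideal_smult R (mpow (Suc n)) Q"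
          using ideal_smult_set_add[OF J mpow_ideal, of "Suc n"] unfolding I_def by blast
        then show "a \<odot>\<^bsub>Q\<^esub> x \<in> ideal_smult R J Q <+>\<^bsub>Q\<^esub> ideal_smult R (mpow n) Q"
          using ideal_smult_mono[OF dec[of n] mpow_carr] by (auto elim!: set_addE intro!: set_addI)
      qed
      then show "a \<in> ideal_closure R Q J" using a by (simp add: ideal_closure_iff[OF J])
    qed
  qed
  then show ?thesis using primary inter by (intro exI[of _ "range I"]) blast
qed

text \<open>With annihilators rewritten as colons, the left side ranges over fewer ideals, so only
  its inclusion in the right side has content. It is checked on the primary family of J, whose
  members contain powers of \<open>\<mm>\<close> and so have finite colength.\<close>

lemma Inter_annihilators_eq_Inter_colons:
  "(\<Inter>I \<in> {I. ideal I R \<and> module_length R (cyclic_module R I) < \<infinity>}.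
      module_annihilator R (cyclic_module R I) (tom R Q (cyclic_module R I)))
    = (\<Inter>I \<in> {I. ideal I R}. colon R I (ideal_closure R Q I))" (is "?L = ?C")
proof
  show "?C \<subseteq> ?L" by (auto simp: annihilator_tom_cyclic_module)
  show "?L \<subseteq> ?C"
  proof (rule subsetI, rule INT_I)
    fix r J assume r: "r \<in> ?L" and "J \<in> {I. ideal I R}"
    then have J: "ideal J R" by simp
    have colon: "r \<in> colon R I (ideal_closure R Q I)" if "ideal I R" "mpow n \<subseteq> I" for I n
      using r that finite_length_if_mpow_le[OF that] annihilator_tom_cyclic_module[OF that(1)] by blast
    \<comment> \<open>The ring itself belongs to the left index set, which places r in R even when
      the family of J is empty.\<close>
    have rc: "r \<in> carrier R"
      using colon[OF oneideal mpow_carr] by (simp add: colon_def)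
    obtain \<I> where \<I>: "\<And>I. I \<in> \<I> \<Longrightarrow> primary_to R \<mm> I"
      and inter: "J = carrier R \<inter> (\<Inter>I\<in>\<I>. I)"
      and cl: "ideal_closure R Q J = carrier R \<inter> (\<Inter>I\<in>\<I>. ideal_closure R Q I)"
      using closure_eq_Inter_primary[OF J] by blast
    have "r \<otimes> u \<in> J" if u: "u \<in> ideal_closure R Q J" for u
    proof -
      have "r \<otimes> u \<in> I" if I: "I \<in> \<I>" for I
      proof -
        have "ideal I R" using \<I>[OF I] by (simp add: primary_to_def primary_ideal_def)
        moreover obtain n where "mpow n \<subseteq> I" using mpow_le_if_primary_to_max[OF \<I>[OF I]] by blast
        ultimately have "r \<in> colon R I (ideal_closure R Q I)" by (rule colon)
        then show ?thesis using u I cl by (auto simp: colon_def)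
      qed
      moreover have "r \<otimes> u \<in> carrier R" using rc u cl by simp
      ultimately show ?thesis using inter by blast
    qed
    then show "r \<in> colon R J (ideal_closure R Q J)" using rc by (simp add: colon_def)
  qed
qed

end

text \<open>The "in particular" clause is the second disjunct of the last assumption, so the same
  conclusion is stated once for both kinds of Q.\<close>

theorem proposition8p25:
  fixes R :: "('a, 'm) ring_scheme" and \<mm> :: "'a set" and Q :: "('a, 'b, 'n) module_scheme"
  assumes "complete_local_noetherian_ring \<mm> R"
    and "module R Q"
    and "(\<forall>J. ideal J R \<longrightarrow>
            adically_separated_module R \<mm> (quotient_module R Q (ideal_smult R J Q)))
         \<or> finitely_generated_module R Q"
  shows "(\<forall>J. ideal J R \<longrightarrow>
            (\<exists>\<I>. (\<forall>I\<in>\<I>. primary_to R \<mm> I) \<and>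
                 J = carrier R \<inter> (\<Inter>I\<in>\<I>. I) \<and>
                 ideal_closure R Q J = carrier R \<inter> (\<Inter>I\<in>\<I>. ideal_closure R Q I)))
       \<and> (\<Inter>I \<in> {I. ideal I R \<and> module_length R (cyclic_module R I) < \<infinity>}.
            module_annihilator R (cyclic_module R I) (tom R Q (cyclic_module R I)))
         = (\<Inter>I \<in> {I. ideal I R}. colon R I (ideal_closure R Q I))"
proof -
  interpret complete_local_noetherian_ring \<mm> R by fact
  interpret noetherian_local_ring \<mm> R ..
  interpret module R Q by fact
  interpret separated_module \<mm> R Q
  proof
    fix J x
    assume J: "ideal J R" and x: "x \<in> carrier Q"
      "\<And>n. x \<in> ideal_smult R J Q <+>\<^bsub>Q\<^esub> ideal_smult R (mpow n) Q"
    have JQ: "submodule (ideal_smult R J Q) R Q" by (rule ideal_smult_submodule[OF ideal_carr[OF J]])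
    show "x \<in> ideal_smult R J Q"
      using assms(3)
    proof
      assume "\<forall>J. ideal J R \<longrightarrow> adically_separated_module R \<mm> (quotient_module R Q (ideal_smult R J Q))"
      then show ?thesis using adically_separated_quotientD[OF JQ mpow_carr _ x] J by blast
    next
      assume "finitely_generated_module R Q"
      then show ?thesis by (rule Krull_intersection[OF assms(2) _ JQ x])
    qed
  qed
  show ?thesis
    using closure_eq_Inter_primary Inter_annihilators_eq_Inter_colons by blast
qed

end
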